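(* Let $M_1,M_2$ be matroids on the same ground set $E$ with $n$ elements, and let $J_k$ be the number of pairs $(I_1,I_2)$, where $I_1$ is an independent set of $M_1$ and $I_2$ is an independent set of $M_2$, such that $I_1\subseteq I_2$ and $|I_2\setminus I_1|=k$. Then for every integer $k$ with $0\leq k\leq n-2$, $$\frac{J_k}{\binom{n}{k}}\cdot \frac{J_{k+2}}{\binom{n}{k+2}}\leq \left(\frac{J_{k+1}}{\binom{n}{k+1}}\right)^2.$$
   Context: Matroids are finite matroids in the usual sense. *)

theory Defs
  imports Complex_Main
begin

locale matroid =
  fixes carrier :: "'a set" and indep :: "'a set \<Rightarrow> bool"
  assumes finite_carrier: "finite carrier"
    and indep_subset_carrier: "indep X \<Longrightarrow> X \<subseteq> carrier"
    and indep_empty: "indep {}"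
    and indep_subset: "indep X \<Longrightarrow> Y \<subseteq> X \<Longrightarrow> indep Y"
    and augment: "indep X \<Longrightarrow> indep Y \<Longrightarrow> card X < card Y \<Longrightarrow> \<exists>x \<in> Y - X. indep (insert x X)"

definition indep_pairs ::
  "('a set \<Rightarrow> bool) \<Rightarrow> ('a set \<Rightarrow> bool) \<Rightarrow> nat \<Rightarrow> ('a set \<times> 'a set) set" where
  "indep_pairs indep\<^sub>1 indep\<^sub>2 k =
     {(I\<^sub>1, I\<^sub>2). indep\<^sub>1 I\<^sub>1 \<and> indep\<^sub>2 I\<^sub>2 \<and> I\<^sub>1 \<subseteq> I\<^sub>2 \<and> card (I\<^sub>2 - I\<^sub>1) = k}"

definition J :: "('a set \<Rightarrow> bool) \<Rightarrow> ('a set \<Rightarrow> bool) \<Rightarrow> nat \<Rightarrow> nat" where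
  "J indep\<^sub>1 indep\<^sub>2 k = card (indep_pairs indep\<^sub>1 indep\<^sub>2 k)"

end

theory Submission
  imports Defs "HOL-Analysis.Convex" "HOL-Analysis.Function_Topology" "HOL-Library.Multiset"
begin

text \<open>
  For a matroid with nullity function \<open>\<nu>\<close> and \<open>0 < q < 1\<close> the polynomials
  \<open>\<Sum>S. q ^ \<nu> S * x^S * z ^ (n - |S|)\<close> and \<open>\<Sum>S. q ^ \<nu> (E - S) * x^S * z ^ (n - |S|)\<close> are Lorentzian.
  Let \<open>\<Phi>\<close> be the product of the second one for \<open>M\<^sub>1\<close> in variables \<open>x, z\<close> and of the first one for
  \<open>M\<^sub>2\<close> in variables \<open>x', z'\<close>; it has degree \<open>2n\<close>. Differentiating \<open>\<Phi>\<close> once along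
  \<open>x e + x' e\<close> for every \<open>e \<in> E\<close> splits \<open>E\<close> into \<open>E - I\<^sub>2\<close> (from \<open>x\<close>) and \<open>I\<^sub>2\<close> (from \<open>x'\<close>);
  differentiating then \<open>k\<close> times along \<open>w = \<Sum>e. x e\<close> enlarges \<open>E - I\<^sub>2\<close> to \<open>E - I\<^sub>1\<close> with
  \<open>|I\<^sub>2 - I\<^sub>1| = k\<close>, and \<open>n - k\<close> times along \<open>z + z'\<close> exhausts the degree. In the limit \<open>q \<rightarrow> 0\<close>
  the resulting number is \<open>k! (n - k)! J\<^sub>k\<close>, so the theorem is the Alexandrov--Fenchel
  inequality for \<open>\<Phi>\<close> and the directions \<open>w\<close> and \<open>z + z'\<close>.

  The Alexandrov--Fenchel inequality follows from its second-order instances at the monomials by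
  induction on the number of general directions: if all partial derivatives of a polynomial satisfy it
  and the support is connected, so does the polynomial. The weights \<open>q ^ \<nu> S\<close> are positive,
  so that the connectedness of the support is immediate; this is why they replace the indicator
  of independence.
\<close>

section \<open>Forms with at most one positive eigenvalue\<close>

definition bil :: "'v set \<Rightarrow> ('v \<Rightarrow> 'v \<Rightarrow> real) \<Rightarrow> ('v \<Rightarrow> real) \<Rightarrow> ('v \<Rightarrow> real) \<Rightarrow> real" where
  "bil V Q x y = (\<Sum>i\<in>V. \<Sum>j\<in>V. x i * Q i j * y j)"

text \<open>At most one positive eigenvalue, phrased as a reverse Cauchy--Schwarz inequality.\<close>
definition hyperbolic :: "'v set \<Rightarrow> ('v \<Rightarrow> 'v \<Rightarrow> real) \<Rightarrow> bool" where
  "hyperbolic V Q \<longleftrightarrow>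
     (\<forall>x y. bil V Q y y > 0 \<longrightarrow> bil V Q x x * bil V Q y y \<le> (bil V Q x y)\<^sup>2)"

lemma bil_commute:
  assumes "\<And>i j. i \<in> V \<Longrightarrow> j \<in> V \<Longrightarrow> Q i j = Q j i"
  shows "bil V Q x y = bil V Q y x"
proof -
  have "bil V Q x y = (\<Sum>j\<in>V. \<Sum>i\<in>V. x i * Q i j * y j)"
    unfolding bil_def by (rule sum.swap)
  also have "\<dots> = bil V Q y x"
    unfolding bil_def using assms by (intro sum.cong refl) (simp add: mult.commute mult.left_commute)
  finally show ?thesis .
qed

lemma bil_add_left: "bil V Q (\<lambda>i. x i + t * y i) z = bil V Q x z + t * bil V Q y z"
  unfolding bil_def by (simp add: sum.distrib sum_distrib_left algebra_simps)

lemma bil_add_right: "bil V Q z (\<lambda>i. x i + t * y i) = bil V Q z x + t * bil V Q z y"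
  unfolding bil_def by (simp add: sum.distrib sum_distrib_left algebra_simps)

text \<open>If the form is positive at \<open>y\<close>, then \<open>l\<close> does not vanish
  there, so some \<open>x + c y\<close> lies in the kernel of \<open>l\<close>. Multiplying its
  nonpositive value by the value at \<open>y\<close> and completing the square leaves the reverse
  Cauchy--Schwarz inequality.\<close>

lemma hyperbolicI:
  assumes sym: "\<And>i j. i \<in> V \<Longrightarrow> j \<in> V \<Longrightarrow> Q i j = Q j i"
    and neg: "\<And>x. (\<Sum>i\<in>V. l i * x i) = 0 \<Longrightarrow> bil V Q x x \<le> 0"
  shows "hyperbolic V Q"
  unfolding hyperbolic_def
proof (intro allI impI)
  fix x y :: "'a \<Rightarrow> real" assume pos: "bil V Q y y > 0"
  let ?L = "\<lambda>x::_ \<Rightarrow> real. \<Sum>i\<in>V. l i * x i"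
  have "?L y \<noteq> 0" using neg[of y] pos by fastforce
  define c where "c = - (?L x / ?L y)"
  have "?L (\<lambda>i. x i + c * y i) = ?L x + c * ?L y"
    by (simp add: sum.distrib sum_distrib_left algebra_simps)
  also have "\<dots> = 0" using \<open>?L y \<noteq> 0\<close> by (simp add: c_def)
  finally have "bil V Q (\<lambda>i. x i + c * y i) (\<lambda>i. x i + c * y i) \<le> 0" by (rule neg)
  then have *: "bil V Q x x + 2 * c * bil V Q x y + c\<^sup>2 * bil V Q y y \<le> 0"
    using bil_commute[of V Q x y, OF sym]
    by (simp add: bil_add_left bil_add_right algebra_simps power2_eq_square)
  have "bil V Q y y * (bil V Q x x + 2 * c * bil V Q x y + c\<^sup>2 * bil V Q y y) \<le> 0"
    using * pos by (simp add: mult_le_0_iff)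
  moreover have "0 \<le> (bil V Q x y + c * bil V Q y y)\<^sup>2" by simp
  ultimately show "bil V Q x x * bil V Q y y \<le> (bil V Q x y)\<^sup>2"
    by (simp add: power2_eq_square algebra_simps)
qed

lemma dirichlet_form:
  fixes K :: "'v \<Rightarrow> 'v \<Rightarrow> real"
  assumes "\<And>i j. i \<in> V \<Longrightarrow> j \<in> V \<Longrightarrow> K i j = K j i"
  shows "(\<Sum>i\<in>V. \<Sum>j\<in>V. K i j * (x i - x j)\<^sup>2) =
         2 * ((\<Sum>i\<in>V. (\<Sum>j\<in>V. K i j) * (x i)\<^sup>2) - bil V K x x)"
proof -
  have "(\<Sum>i\<in>V. \<Sum>j\<in>V. K i j * (x i - x j)\<^sup>2) =
     (\<Sum>i\<in>V. \<Sum>j\<in>V. K i j * (x i)\<^sup>2) + (\<Sum>i\<in>V. \<Sum>j\<in>V. K i j * (x j)\<^sup>2) - 2 * bil V K x x"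
    by (simp add: bil_def sum_distrib_left sum.distrib sum_subtractf algebra_simps power2_eq_square)
  moreover have "(\<Sum>i\<in>V. \<Sum>j\<in>V. K i j * (x j)\<^sup>2) = (\<Sum>j\<in>V. \<Sum>i\<in>V. K i j * (x j)\<^sup>2)"
    by (rule sum.swap)
  moreover have "\<dots> = (\<Sum>i\<in>V. \<Sum>j\<in>V. K i j * (x i)\<^sup>2)"
    using assms by (intro sum.cong refl) simp
  ultimately show ?thesis by (simp add: sum_distrib_right)
qed

text \<open>The first-order condition at a maximum: otherwise a small \<open>t\<close> with the sign
  of \<open>a\<close> makes the linear term win. It serves in place of differentiation in
  \<open>markov_gap\<close>.\<close>

lemma linear_le_quadratic_imp_zero:
  fixes a b :: real
  assumes "\<And>t. t * a \<le> t\<^sup>2 * b"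
  shows "a = 0"
proof (rule ccontr)
  assume "a \<noteq> 0"
  define t where "t = a / (\<bar>b\<bar> + 1)"
  have "t * a \<le> t\<^sup>2 * b" by (rule assms)
  also have "\<dots> \<le> t\<^sup>2 * \<bar>b\<bar>" by (simp add: mult_left_mono)
  finally have "a\<^sup>2 / (\<bar>b\<bar> + 1) \<le> a\<^sup>2 / (\<bar>b\<bar> + 1) * (\<bar>b\<bar> / (\<bar>b\<bar> + 1))"
    by (simp add: t_def power2_eq_square)
  moreover have "a\<^sup>2 / (\<bar>b\<bar> + 1) > 0" using \<open>a \<noteq> 0\<close> by (simp add: add_nonneg_pos)
  ultimately have "1 \<le> \<bar>b\<bar> / (\<bar>b\<bar> + 1)"
    by (metis mult.right_neutral mult_le_cancel_left_pos)
  then show False by (simp add: field_simps)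
qed

text \<open>Requiring the functions to vanish off \<open>V\<close> places the set inside a product
  of compact intervals and singletons, which is compact by Tychonoff; the set is closed in
  it.\<close>

lemma compact_weighted_sphere:
  fixes p :: "'v \<Rightarrow> real"
  assumes fin: "finite V" and pos: "\<And>i. i \<in> V \<Longrightarrow> p i > 0"
  shows "compact {y. (\<forall>i. i \<notin> V \<longrightarrow> y i = 0) \<and> (\<Sum>i\<in>V. p i * (y i)\<^sup>2) = 1 \<and> (\<Sum>i\<in>V. p i * y i) = 0}"
    (is "compact ?S")
proof -
  \<comment> \<open>The squared norm bounds \<open>(y i)\<^sup>2\<close> by \<open>1 / p i\<close>;
    the larger radius \<open>1 + 1 / p i\<close> avoids a square root.\<close>
  define B where "B = (\<lambda>i. if i \<in> V then {- (1 + 1 / p i) .. 1 + 1 / p i} else {0::real})"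
  have "compactin (product_topology (\<lambda>i. euclidean) UNIV) (PiE UNIV B)"
    by (subst compactin_PiE) (auto simp: B_def)
  then have cB: "compact (PiE UNIV B)"
    by (simp add: euclidean_product_topology)
  have "?S \<subseteq> PiE UNIV B"
  proof
    fix y assume y: "y \<in> ?S"
    have "y i \<in> B i" for i
    proof (cases "i \<in> V")
      case True
      have "p i * (y i)\<^sup>2 \<le> (\<Sum>i\<in>V. p i * (y i)\<^sup>2)"
        using True fin pos by (intro member_le_sum) (auto simp: less_imp_le)
      then have "(y i)\<^sup>2 \<le> 1 / p i" using y pos[OF True] by (simp add: field_simps)
      also have "\<dots> \<le> (1 + 1 / p i)\<^sup>2"
        using pos[OF True] by (simp add: power2_eq_square field_simps)
      finally have "\<bar>y i\<bar> \<le> \<bar>1 + 1 / p i\<bar>" by (simp only: abs_le_square_iff)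
      then have "\<bar>y i\<bar> \<le> 1 + 1 / p i"
        using pos[OF True] by (simp add: abs_of_pos add_pos_pos)
      then show ?thesis using True by (auto simp: B_def)
    qed (use y in \<open>auto simp: B_def\<close>)
    then show "y \<in> PiE UNIV B" by auto
  qed
  moreover have "closed ?S"
  proof -
    have "closed {y::'v\<Rightarrow>real. i \<notin> V \<longrightarrow> y i = 0}" for i
      by (cases "i \<in> V") (auto intro!: closed_Collect_eq continuous_intros)
    then show ?thesis
      by (auto intro!: closed_Collect_conj closed_Collect_all closed_Collect_eq continuous_intros)
  qed
  ultimately show ?thesis
    using cB closed_Int_compact[of ?S "PiE UNIV B"] by (simp add: Int_absorb2)
qed

text \<open>
  \<open>K\<close> is a reversible Markov chain with stationary weights \<open>p\<close> and transition operator
  \<open>A = K / p\<close>. The hypothesis \<open>sq\<close> says \<open>A \<le> A\<^sup>2\<close>, so no eigenvalue lies in \<open>(0, 1)\<close>; the Dirichlet form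
  gives \<open>A \<le> 1\<close>, and connectedness makes the eigenvalue \<open>1\<close> simple. Hence \<open>A \<le> 0\<close> on the complement
  of the constants. The maximum \<open>l\<close> of the Rayleigh quotient there stands in for the spectral theorem.
\<close>
lemma markov_gap:
  fixes K :: "'v \<Rightarrow> 'v \<Rightarrow> real"
  defines "p \<equiv> \<lambda>V i. \<Sum>j\<in>V. K i j"
  assumes fin: "finite V"
    and sym: "\<And>i j. i \<in> V \<Longrightarrow> j \<in> V \<Longrightarrow> K i j = K j i"
    and nonneg: "\<And>i j. i \<in> V \<Longrightarrow> j \<in> V \<Longrightarrow> K i j \<ge> 0"
    and pos: "\<And>i. i \<in> V \<Longrightarrow> p V i > 0"
    and conn: "\<And>i j. i \<in> V \<Longrightarrow> j \<in> V \<Longrightarrow> K i j > 0 \<or> (\<exists>k\<in>V. K i k > 0 \<and> K k j > 0)"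
    and sq: "\<And>x. bil V K x x \<le> (\<Sum>i\<in>V. (\<Sum>j\<in>V. K i j * x j)\<^sup>2 / p V i)"
    and orth: "(\<Sum>i\<in>V. p V i * x i) = 0"
  shows "bil V K x x \<le> 0"
proof (rule ccontr)
  assume "\<not> bil V K x x \<le> 0"
  then have qx: "bil V K x x > 0" by simp
  let ?p = "p V"
  let ?N = "\<lambda>y::_ \<Rightarrow> real. \<Sum>i\<in>V. ?p i * (y i)\<^sup>2"
  let ?S = "{y. (\<forall>i. i \<notin> V \<longrightarrow> y i = 0) \<and> ?N y = 1 \<and> (\<Sum>i\<in>V. ?p i * y i) = 0}"
  define R where "R = (\<lambda>y i. if i \<in> V then y i / sqrt (?N y) else 0)"
  have Nnn: "?N y \<ge> 0" for y using pos by (intro sum_nonneg) (simp add: less_imp_le)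
  have N0: "bil V K y y = 0" if "?N y = 0" for y
  proof -
    have "\<forall>i\<in>V. ?p i * (y i)\<^sup>2 = 0"
      using that fin pos by (subst sum_nonneg_eq_0_iff[symmetric]) (auto simp: less_imp_le)
    then have "\<forall>i\<in>V. y i = 0" using pos by fastforce
    then show ?thesis by (simp add: bil_def)
  qed
  have RS: "R y \<in> ?S" and Rq: "bil V K (R y) (R y) = bil V K y y / ?N y"
    if "(\<Sum>i\<in>V. ?p i * y i) = 0" "?N y > 0" for y
  proof -
    have "?N (R y) = (\<Sum>i\<in>V. ?p i * (y i)\<^sup>2 / ?N y)"
      using that by (intro sum.cong refl) (simp add: R_def power_divide)
    also have "\<dots> = 1" using that by (simp flip: sum_divide_distrib)
    finally have "?N (R y) = 1" .
    moreover have "(\<Sum>i\<in>V. ?p i * R y i) = (\<Sum>i\<in>V. ?p i * y i / sqrt (?N y))"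
      by (intro sum.cong refl) (simp add: R_def)
    then have "(\<Sum>i\<in>V. ?p i * R y i) = 0" using that by (simp flip: sum_divide_distrib)
    ultimately show "R y \<in> ?S" by (simp add: R_def)
    have "bil V K (R y) (R y) = (\<Sum>i\<in>V. \<Sum>j\<in>V. y i * K i j * y j / (sqrt (?N y) * sqrt (?N y)))"
      unfolding bil_def by (intro sum.cong refl) (simp add: R_def)
    also have "\<dots> = bil V K y y / (sqrt (?N y) * sqrt (?N y))"
      by (simp add: bil_def flip: sum_divide_distrib)
    finally show "bil V K (R y) (R y) = bil V K y y / ?N y" using that by simp
  qed
  have "?N x > 0" using N0[of x] qx Nnn[of x] by fastforce
  then have ne: "?S \<noteq> {}" using RS[OF orth] by blast
  have co: "compact ?S" by (rule compact_weighted_sphere[OF fin pos])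
  have cont: "continuous_on ?S (\<lambda>y. bil V K y y)"
    unfolding bil_def by (intro continuous_intros continuous_on_product_then_coordinatewise continuous_on_id)
  obtain y where y: "y \<in> ?S" and max: "\<And>h. h \<in> ?S \<Longrightarrow> bil V K h h \<le> bil V K y y"
    using continuous_attains_sup[OF co ne cont] by blast
  define l where "l = bil V K y y"
  have le: "bil V K h h \<le> l * ?N h" if "(\<Sum>i\<in>V. ?p i * h i) = 0" for h
  proof (cases "?N h = 0")
    case True then show ?thesis using N0[of h] by simp
  next
    case False
    then have pN: "?N h > 0" using Nnn[of h] by linarith
    then have "bil V K h h / ?N h \<le> l" using max[OF RS[OF that pN]] Rq[OF that pN] by (simp add: l_def)
    then show ?thesis using pN by (simp add: field_simps)
  qed
  have Ny: "?N y = 1" and oy: "(\<Sum>i\<in>V. ?p i * y i) = 0" using y by auto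
  have "0 < bil V K x x / ?N x" using qx \<open>?N x > 0\<close> by simp
  then have lpos: "l > 0" using max[OF RS[OF orth]] Rq[OF orth] \<open>?N x > 0\<close> by (simp add: l_def)
  \<comment> \<open>\<open>g\<close> is \<open>A y\<close>, the direction in which the maximizer
    \<open>y\<close> is perturbed. It is again orthogonal to the constants, so the perturbation
    stays admissible.\<close>
  define g where "g = (\<lambda>i. (\<Sum>j\<in>V. K i j * y j) / ?p i)"
  have pg: "?p i * g i = (\<Sum>j\<in>V. K i j * y j)" if "i \<in> V" for i
    using pos[OF that] by (simp add: g_def)
  have "(\<Sum>i\<in>V. ?p i * g i) = (\<Sum>i\<in>V. \<Sum>j\<in>V. K i j * y j)" using pg by (intro sum.cong) auto
  also have "\<dots> = (\<Sum>j\<in>V. \<Sum>i\<in>V. K i j * y j)" by (rule sum.swap)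
  also have "\<dots> = (\<Sum>j\<in>V. ?p j * y j)"
    unfolding p_def sum_distrib_right using sym by (intro sum.cong refl) simp
  finally have og: "(\<Sum>i\<in>V. ?p i * g i) = 0" using oy by simp
  have gy: "bil V K g y = ?N g"
    unfolding bil_def
  proof (intro sum.cong refl)
    fix i assume "i \<in> V"
    have "(\<Sum>j\<in>V. g i * K i j * y j) = g i * (\<Sum>j\<in>V. K i j * y j)"
      by (simp add: sum_distrib_left mult.assoc)
    also have "\<dots> = ?p i * (g i)\<^sup>2" using pg[OF \<open>i \<in> V\<close>] by (simp add: power2_eq_square algebra_simps)
    finally show "(\<Sum>j\<in>V. g i * K i j * y j) = ?p i * (g i)\<^sup>2" .
  qed
  have yg: "(\<Sum>i\<in>V. ?p i * y i * g i) = l"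
    unfolding l_def bil_def
  proof (intro sum.cong refl)
    fix i assume "i \<in> V"
    have "?p i * y i * g i = y i * (\<Sum>j\<in>V. K i j * y j)" using pg[OF \<open>i \<in> V\<close>] by (simp add: algebra_simps)
    then show "?p i * y i * g i = (\<Sum>j\<in>V. y i * K i j * y j)" by (simp add: sum_distrib_left mult.assoc)
  qed
  \<comment> \<open>Stationarity of the Rayleigh quotient at \<open>y\<close> in the direction
    \<open>A y\<close> gives that the squared norm of \<open>A y\<close> is \<open>l * l\<close>.
    This suffices without showing that \<open>y\<close> is an eigenvector: with \<open>sq\<close> it
    yields \<open>l \<le> l * l\<close>, hence \<open>l \<ge> 1\<close>.\<close>
  have "2 * (?N g - l * l) = 0"
  proof (rule linear_le_quadratic_imp_zero)
    fix t :: real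
    let ?h = "\<lambda>i. y i + t * g i"
    have "(\<Sum>i\<in>V. ?p i * ?h i) = (\<Sum>i\<in>V. ?p i * y i) + t * (\<Sum>i\<in>V. ?p i * g i)"
      by (simp add: sum.distrib sum_distrib_left algebra_simps)
    then have "bil V K ?h ?h \<le> l * ?N ?h" using oy og by (intro le) simp
    moreover have "bil V K ?h ?h = l + 2 * t * ?N g + t\<^sup>2 * bil V K g g"
      using bil_commute[of V K y g, OF sym] gy
      by (simp add: bil_add_left bil_add_right l_def algebra_simps power2_eq_square)
    moreover have "?N ?h = ?N y + 2 * t * (\<Sum>i\<in>V. ?p i * y i * g i) + t\<^sup>2 * ?N g"
      by (simp add: sum.distrib sum_distrib_left algebra_simps power2_eq_square)
    ultimately show "t * (2 * (?N g - l * l)) \<le> t\<^sup>2 * (l * ?N g - bil V K g g)"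
      using Ny yg by (simp add: algebra_simps)
  qed
  then have "?N g = l * l" by simp
  moreover have "l \<le> (\<Sum>i\<in>V. (\<Sum>j\<in>V. K i j * y j)\<^sup>2 / ?p i)" unfolding l_def by (rule sq)
  moreover have "(\<Sum>i\<in>V. (\<Sum>j\<in>V. K i j * y j)\<^sup>2 / ?p i) = ?N g"
  proof (intro sum.cong refl)
    fix i assume i: "i \<in> V"
    show "(\<Sum>j\<in>V. K i j * y j)\<^sup>2 / ?p i = ?p i * (g i)\<^sup>2"
      using pos[OF i] by (simp add: g_def power_divide power2_eq_square)
  qed
  ultimately have "l \<ge> 1" using lpos by simp
  let ?D = "\<lambda>i j. K i j * (y i - y j)\<^sup>2"
  have D0: "?D i j \<ge> 0" if "i \<in> V" "j \<in> V" for i j using nonneg that by simp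
  \<comment> \<open>With \<open>l \<ge> 1\<close> the nonnegative Dirichlet sum must vanish, so
    \<open>y\<close> is constant along edges and, by \<open>conn\<close>, on all of
    \<open>V\<close>. Orthogonality then forces \<open>y\<close> to be zero, against norm
    one.\<close>
  have "(\<Sum>i\<in>V. \<Sum>j\<in>V. ?D i j) = 2 * (1 - l)"
    using dirichlet_form[of V K y] sym Ny by (simp add: p_def l_def)
  then have "(\<Sum>i\<in>V. \<Sum>j\<in>V. ?D i j) \<le> 0" using \<open>l \<ge> 1\<close> by simp
  moreover have "(\<Sum>i\<in>V. \<Sum>j\<in>V. ?D i j) \<ge> 0" using D0 by (intro sum_nonneg)
  ultimately have "(\<Sum>i\<in>V. \<Sum>j\<in>V. ?D i j) = 0" by linarith
  then have D: "?D i j = 0" if "i \<in> V" "j \<in> V" for i j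
    using that D0 fin by (simp add: sum_nonneg_eq_0_iff sum_nonneg)
  have edge: "y i = y j" if "i \<in> V" "j \<in> V" "K i j > 0" for i j
    using D[OF that(1,2)] that(3) by simp
  have const: "y i = y j" if "i \<in> V" "j \<in> V" for i j
    using conn[OF that] edge that by metis
  have "V \<noteq> {}" using Ny by auto
  then obtain a where a: "a \<in> V" by blast
  have "(\<Sum>i\<in>V. ?p i * y i) = (\<Sum>i\<in>V. ?p i) * y a"
    unfolding sum_distrib_right using const[OF _ a] by (intro sum.cong) auto
  moreover have "(\<Sum>i\<in>V. ?p i) > 0" using fin \<open>V \<noteq> {}\<close> pos by (intro sum_pos)
  ultimately have "y a = 0" using oy by simp
  then have "?N y = 0" using const[OF _ a] by simp
  with Ny show False by simp
qed

text \<open>\<open>T\<close> is a symmetric tensor of third derivatives and \<open>Q V v\<close> its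
  contraction with \<open>v\<close>. Rescaling the variables by \<open>v\<close> turns
  \<open>Q V v\<close> into a reversible Markov kernel \<open>K\<close>; the reverse Cauchy--Schwarz
  inequalities of the slices \<open>T k\<close> against \<open>v\<close>, summed with weights
  \<open>v k\<close>, are the hypothesis \<open>sq\<close> of \<open>markov_gap\<close>.\<close>

lemma hyperbolic_step:
  fixes T :: "'v \<Rightarrow> 'v \<Rightarrow> 'v \<Rightarrow> real"
  defines "Q \<equiv> \<lambda>V v i j. \<Sum>k\<in>V. v k * T k i j"
  assumes fin: "finite V"
    and sym1: "\<And>i j k. T i j k = T j i k"
    and sym2: "\<And>i j k. T i j k = T i k j"
    and nonneg: "\<And>i j k. i \<in> V \<Longrightarrow> j \<in> V \<Longrightarrow> k \<in> V \<Longrightarrow> T i j k \<ge> 0"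
    and hyp: "\<And>i. i \<in> V \<Longrightarrow> hyperbolic V (T i)"
    and vpos: "\<And>i. i \<in> V \<Longrightarrow> v i > 0"
    and conn: "\<And>i j. i \<in> V \<Longrightarrow> j \<in> V \<Longrightarrow> (\<exists>k\<in>V. Q V v i k > 0) \<Longrightarrow> (\<exists>k\<in>V. Q V v j k > 0) \<Longrightarrow>
        Q V v i j > 0 \<or> (\<exists>k\<in>V. Q V v i k > 0 \<and> Q V v k j > 0)"
  shows "hyperbolic V (Q V v)"
proof -
  let ?Q = "Q V v"
  have Qsym: "?Q i j = ?Q j i" for i j unfolding Q_def using sym2 by metis
  have Qnn: "?Q i j \<ge> 0" if "i \<in> V" "j \<in> V" for i j
    unfolding Q_def using that nonneg vpos by (intro sum_nonneg mult_nonneg_nonneg) (auto simp: less_imp_le)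
  define s where "s = (\<lambda>i. \<Sum>j\<in>V. ?Q i j * v j)"
  have Qv: "?Q i j = (\<Sum>k\<in>V. T i j k * v k)" for i j
    unfolding Q_def using sym1 sym2 by (intro sum.cong refl) (metis mult.commute)
  have Tv: "bil V (T i) x v = (\<Sum>j\<in>V. x j * ?Q i j)" for i x
    unfolding bil_def Qv by (simp add: sum_distrib_left mult.assoc)
  have snn: "s i \<ge> 0" if "i \<in> V" for i
    unfolding s_def using that Qnn vpos by (intro sum_nonneg mult_nonneg_nonneg) (auto simp: less_imp_le)
  have sv: "bil V (T i) v v = s i" for i unfolding Tv s_def by (simp add: mult.commute)
  \<comment> \<open>Where \<open>s i = 0\<close>, row \<open>i\<close> of \<open>Q V v\<close> and
    the slice \<open>T i\<close> vanish on \<open>V\<close>. Restricting to \<open>W\<close> makes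
    all weights of the chain positive and loses nothing.\<close>
  define W where "W = {i \<in> V. s i > 0}"
  have WV: "W \<subseteq> V" and finW: "finite W" using fin by (auto simp: W_def)
  have s0: "?Q i j = 0" if "i \<in> V - W" "j \<in> V" for i j
  proof -
    have "s i = 0" using that snn[of i] by (auto simp: W_def)
    then have "\<forall>j\<in>V. ?Q i j * v j = 0"
      unfolding s_def using that Qnn vpos fin
      by (subst sum_nonneg_eq_0_iff[symmetric]) (auto simp: less_imp_le)
    then show ?thesis using that vpos by fastforce
  qed
  have s0': "?Q j i = 0" if "i \<in> V - W" "j \<in> V" for i j
    using s0[OF that] Qsym[of j i] by simp
  have T0: "bil V (T i) x x = 0" if "i \<in> V - W" for i x
  proof -
    have "T i j k = 0" if "j \<in> V" "k \<in> V" for j k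
    proof -
      have "(\<Sum>k\<in>V. T i j k * v k) = 0" using s0[OF \<open>i \<in> V - W\<close> \<open>j \<in> V\<close>] by (simp add: Qv)
      then have "\<forall>k\<in>V. T i j k * v k = 0"
        using that \<open>i \<in> V - W\<close> nonneg vpos fin
        by (subst sum_nonneg_eq_0_iff[symmetric]) (auto simp: less_imp_le)
      then show ?thesis using that vpos by fastforce
    qed
    then show ?thesis by (simp add: bil_def)
  qed
  define K where "K = (\<lambda>i j. v i * ?Q i j * v j)"
  have Kp: "(\<Sum>j\<in>W. K i j) = v i * s i" if "i \<in> V" for i
  proof -
    have "(\<Sum>j\<in>W. K i j) = (\<Sum>j\<in>V. K i j)"
      using WV fin s0' that by (intro sum.mono_neutral_left) (auto simp: K_def)
    then show ?thesis by (simp add: K_def s_def sum_distrib_left mult.assoc)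
  qed
  have bilK: "bil W K x x = bil V ?Q (\<lambda>i. v i * x i) (\<lambda>i. v i * x i)" for x
  proof -
    have "bil V ?Q (\<lambda>i. v i * x i) (\<lambda>i. v i * x i) = bil V K x x"
      unfolding bil_def K_def by (intro sum.cong refl) (simp add: algebra_simps)
    also have "\<dots> = (\<Sum>i\<in>V. \<Sum>j\<in>W. x i * K i j * x j)"
      unfolding bil_def using WV fin s0'
      by (intro sum.cong[OF refl] sum.mono_neutral_right) (auto simp: K_def)
    also have "\<dots> = (\<Sum>i\<in>W. \<Sum>j\<in>W. x i * K i j * x j)"
      using WV fin s0 by (intro sum.mono_neutral_right) (auto simp: K_def intro!: sum.neutral)
    finally show ?thesis by (simp add: bil_def)
  qed
  have gap: "bil W K x x \<le> 0" if "(\<Sum>i\<in>W. (\<Sum>j\<in>W. K i j) * x i) = 0" for x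
  proof (rule markov_gap[OF finW _ _ _ _ _ that])
    show "K i j = K j i" for i j unfolding K_def using Qsym by (simp add: algebra_simps)
    show "K i j \<ge> 0" if "i \<in> W" "j \<in> W" for i j
      unfolding K_def using that WV Qnn vpos by (auto intro!: mult_nonneg_nonneg simp: less_imp_le subset_iff)
    show "(\<Sum>j\<in>W. K i j) > 0" if "i \<in> W" for i
      using that Kp vpos by (auto simp: W_def)
    have Kpos: "K i j > 0 \<longleftrightarrow> ?Q i j > 0" if "i \<in> V" "j \<in> V" for i j
      unfolding K_def using vpos[OF that(1)] vpos[OF that(2)] by (simp add: zero_less_mult_iff)
    have ex: "\<exists>k\<in>V. ?Q i k > 0" if "i \<in> W" for i
    proof (rule ccontr)
      assume "\<not> ?thesis"
      then have "\<forall>k\<in>V. ?Q i k = 0" using Qnn that WV by (meson antisym_conv2 less_imp_le linorder_not_less subsetD)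
      then have "s i = 0" by (simp add: s_def)
      then show False using that by (simp add: W_def)
    qed
    show "K i j > 0 \<or> (\<exists>k\<in>W. K i k > 0 \<and> K k j > 0)" if "i \<in> W" "j \<in> W" for i j
    proof -
      have "?Q i j > 0 \<or> (\<exists>k\<in>V. ?Q i k > 0 \<and> ?Q k j > 0)"
        using conn[of i j] ex that WV by blast
      \<comment> \<open>The intermediate index has a positive entry in its row and therefore
        survives the restriction.\<close>
      moreover have "k \<in> W" if "k \<in> V" "?Q k j > 0" for k
        using s0[of k j] that \<open>j \<in> W\<close> WV by force
      ultimately show ?thesis using Kpos that WV by (metis subsetD)
    qed
    fix x :: "'v \<Rightarrow> real"
    let ?x = "\<lambda>i. v i * x i"
    have "bil W K x x = bil V ?Q ?x ?x" by (rule bilK)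
    also have "\<dots> = (\<Sum>i\<in>V. \<Sum>j\<in>V. \<Sum>k\<in>V. ?x i * (v k * T k i j) * ?x j)"
      unfolding bil_def Q_def by (simp add: sum_distrib_left sum_distrib_right)
    also have "\<dots> = (\<Sum>i\<in>V. \<Sum>k\<in>V. \<Sum>j\<in>V. ?x i * (v k * T k i j) * ?x j)"
      by (intro sum.cong refl sum.swap)
    also have "\<dots> = (\<Sum>k\<in>V. \<Sum>i\<in>V. \<Sum>j\<in>V. ?x i * (v k * T k i j) * ?x j)"
      by (rule sum.swap)
    also have "\<dots> = (\<Sum>k\<in>V. v k * bil V (T k) ?x ?x)"
      unfolding bil_def by (simp add: sum_distrib_left algebra_simps)
    also have "\<dots> = (\<Sum>k\<in>W. v k * bil V (T k) ?x ?x)"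
      using WV fin T0 by (intro sum.mono_neutral_right) auto
    also have "\<dots> \<le> (\<Sum>k\<in>W. (\<Sum>j\<in>W. K k j * x j)\<^sup>2 / (\<Sum>j\<in>W. K k j))"
    proof (rule sum_mono)
      fix k assume k: "k \<in> W"
      then have kV: "k \<in> V" and sk: "s k > 0" using WV by (auto simp: W_def)
      have vk: "v k > 0" using vpos[OF kV] .
      have "bil V (T k) ?x ?x * s k \<le> (\<Sum>j\<in>V. ?x j * ?Q k j)\<^sup>2"
        using hyp[OF kV] sk unfolding hyperbolic_def by (metis sv Tv)
      then have "bil V (T k) ?x ?x \<le> (\<Sum>j\<in>V. ?x j * ?Q k j)\<^sup>2 / s k"
        using sk by (simp add: field_simps)
      then have "v k * bil V (T k) ?x ?x \<le> v k * ((\<Sum>j\<in>V. ?x j * ?Q k j)\<^sup>2 / s k)"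
        using vk by (intro mult_left_mono) auto
      also have "\<dots> = (v k * (\<Sum>j\<in>V. ?x j * ?Q k j))\<^sup>2 / (v k * s k)"
        using vk by (simp add: power2_eq_square)
      also have "v k * (\<Sum>j\<in>V. ?x j * ?Q k j) = (\<Sum>j\<in>V. K k j * x j)"
        unfolding K_def by (simp add: sum_distrib_left algebra_simps)
      also have "\<dots> = (\<Sum>j\<in>W. K k j * x j)"
        using WV fin s0' kV by (intro sum.mono_neutral_right) (auto simp: K_def)
      finally show "v k * bil V (T k) ?x ?x \<le> (\<Sum>j\<in>W. K k j * x j)\<^sup>2 / (\<Sum>j\<in>W. K k j)"
        using Kp[OF kV] by simp
    qed
    finally show "bil W K x x \<le> (\<Sum>i\<in>W. (\<Sum>j\<in>W. K i j * x j)\<^sup>2 / (\<Sum>j\<in>W. K i j))" .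
  qed
  show ?thesis
  \<comment> \<open>In the variable \<open>x / v\<close> the kernel of \<open>s\<close> becomes the
    orthogonal complement of the constants for the weights \<open>v i * s i\<close>.\<close>
  proof (rule hyperbolicI[where l = s])
    show "?Q i j = ?Q j i" for i j by (rule Qsym)
    fix x assume 0: "(\<Sum>i\<in>V. s i * x i) = 0"
    define y where "y = (\<lambda>i. x i / v i)"
    have vy: "v i * y i = x i" if "i \<in> V" for i using vpos[OF that] by (simp add: y_def)
    have "(\<Sum>i\<in>W. (\<Sum>j\<in>W. K i j) * y i) = (\<Sum>i\<in>W. s i * x i)"
      using WV vy Kp by (intro sum.cong refl) (auto simp: algebra_simps subset_iff)
    also have "\<dots> = (\<Sum>i\<in>V. s i * x i)"
      using WV fin snn by (intro sum.mono_neutral_left) (force simp: W_def)+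
    finally have "bil W K y y \<le> 0" using 0 by (intro gap) simp
    moreover have "bil V ?Q x x = bil V ?Q (\<lambda>i. v i * y i) (\<lambda>i. v i * y i)"
      unfolding bil_def using vy by (intro sum.cong refl) simp
    ultimately show "bil V ?Q x x \<le> 0" unfolding bilK by simp
  qed
qed

section \<open>Mixed derivatives and the Alexandrov--Fenchel inequality\<close>

text \<open>
  A homogeneous polynomial of degree \<open>d\<close> is encoded by the function \<open>c\<close> sending a multiset \<open>m\<close> of
  \<open>d\<close> variables to the iterated partial derivative along \<open>m\<close> (so \<open>c m\<close> is the coefficient times the
  factorials of the multiplicities); \<open>mixed V c vs m\<close> is its derivative along \<open>m\<close> and the vectors \<open>vs\<close>.
\<close>
fun mixed :: "'v set \<Rightarrow> ('v multiset \<Rightarrow> real) \<Rightarrow> ('v \<Rightarrow> real) list \<Rightarrow> 'v multiset \<Rightarrow> real" where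
  "mixed V c [] m = c m"
| "mixed V c (v # vs) m = (\<Sum>a\<in>V. v a * mixed V c vs (add_mset a m))"

lemma mixed_nonneg:
  assumes "\<And>m. c m \<ge> 0" "\<And>v a. v \<in> set vs \<Longrightarrow> a \<in> V \<Longrightarrow> v a \<ge> 0"
  shows "mixed V c vs m \<ge> 0"
  using assms(2)
proof (induction vs arbitrary: m)
  case (Cons v vs)
  then show ?case by (auto intro!: sum_nonneg mult_nonneg_nonneg)
qed (simp add: assms(1))

lemma mixed_Cons_Cons:
  "mixed V c (x # y # vs) m = bil V (\<lambda>a b. mixed V c vs (add_mset a (add_mset b m))) x y"
  by (simp add: bil_def sum_distrib_left add_mset_commute mult.left_commute mult.assoc)
    (simp add: mult.commute)

lemma mixed_move: "mixed V c (vs @ x # ws) m = mixed V c (x # vs @ ws) m"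
proof (induction vs arbitrary: m)
  case (Cons v vs)
  have "mixed V c ((v # vs) @ x # ws) m = (\<Sum>a\<in>V. \<Sum>b\<in>V. v a * (x b * mixed V c (vs @ ws) (add_mset b (add_mset a m))))"
    using Cons by (simp add: sum_distrib_left)
  also have "\<dots> = (\<Sum>b\<in>V. \<Sum>a\<in>V. v a * (x b * mixed V c (vs @ ws) (add_mset b (add_mset a m))))"
    by (rule sum.swap)
  also have "\<dots> = mixed V c (x # (v # vs) @ ws) m"
    by (simp add: sum_distrib_left add_mset_commute mult.left_commute)
  finally show ?case .
qed simp

lemma mixed_mset:
  assumes "mset vs = mset ws"
  shows "mixed V c vs m = mixed V c ws m"
  using assms
proof (induction vs arbitrary: ws m)
  case (Cons v vs)
  then have "v \<in> set ws" by (metis list.set_intros(1) set_mset_mset)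
  then obtain as bs where ws: "ws = as @ v # bs" by (meson split_list)
  then have "mset vs = mset (as @ bs)" using Cons.prems by simp
  then have "mixed V c (v # vs) m = mixed V c (v # as @ bs) m" using Cons.IH[of "as @ bs"] by simp
  then show ?case by (simp only: ws mixed_move)
qed simp

text \<open>The shift by \<open>q\<close> turns nonnegative directions into strictly positive ones,
  as \<open>hyperbolic_mixed\<close> demands; it disappears in the same limit as the perturbation of
  the coefficients.\<close>

lemma tendsto_mixed:
  assumes "\<And>m. ((\<lambda>q. C q m) \<longlongrightarrow> c m) (at_right (0::real))"
  shows "((\<lambda>q. mixed V (C q) (map (\<lambda>v a. v a + q) vs) m) \<longlongrightarrow> mixed V c vs m) (at_right 0)"
proof (induction vs arbitrary: m)
  case (Cons v vs)
  have "((\<lambda>q. v a + q) \<longlongrightarrow> v a + 0) (at_right 0)" for a by (intro tendsto_intros)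
  then show ?case using Cons by (auto intro!: tendsto_intros)
qed (simp add: assms)

lemma mixed_zero_outside_support:
  assumes "\<And>m. size m = d \<Longrightarrow> \<not> P m \<Longrightarrow> c m = 0" "\<And>a m. P (add_mset a m) \<Longrightarrow> P m"
    and "\<not> P m" "size m + length vs = d"
  shows "mixed V c vs m = 0"
  using assms(3,4)
proof (induction vs arbitrary: m)
  case (Cons v vs)
  have "mixed V c vs (add_mset a m) = 0" for a
    using Cons.prems assms(2) by (intro Cons.IH) auto
  then show ?case by simp
qed (auto intro: assms(1))

text \<open>\<open>P\<close> describes the nonvanishing derivatives of all orders at once.
  Connectedness is asked for in the form of paths of length at most two, and only where at least one
  general direction is left to apply, which is what \<open>hyperbolic_step\<close> consumes.\<close>

locale lorentzian_coeffs =
  fixes V :: "'v set" and d :: nat and c :: "'v multiset \<Rightarrow> real" and P :: "'v multiset \<Rightarrow> bool"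
  assumes finite_V: "finite V"
    and nonneg: "c m \<ge> 0"
    and pos: "size m = d \<Longrightarrow> P m \<Longrightarrow> c m > 0"
    and zero: "size m = d \<Longrightarrow> \<not> P m \<Longrightarrow> c m = 0"
    and support_mono: "P (add_mset a m) \<Longrightarrow> P m"
    and support_extend: "P m \<Longrightarrow> size m < d \<Longrightarrow> \<exists>a\<in>V. P (add_mset a m)"
    and support_connected: "size m + 3 \<le> d \<Longrightarrow> i \<in> V \<Longrightarrow> j \<in> V \<Longrightarrow>
      P (add_mset i m) \<Longrightarrow> P (add_mset j m) \<Longrightarrow>
      P (add_mset i (add_mset j m)) \<or>
      (\<exists>k\<in>V. P (add_mset i (add_mset k m)) \<and> P (add_mset k (add_mset j m)))"
    and base: "size m + 2 = d \<Longrightarrow> set_mset m \<subseteq> V \<Longrightarrow>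
      hyperbolic V (\<lambda>i j. c (add_mset i (add_mset j m)))"
begin

lemma mixed_pos:
  assumes "P m" "size m + length vs = d" "\<And>v a. v \<in> set vs \<Longrightarrow> a \<in> V \<Longrightarrow> v a > 0"
  shows "mixed V c vs m > 0"
  using assms
proof (induction vs arbitrary: m)
  case (Cons v vs)
  obtain a where a: "a \<in> V" "P (add_mset a m)" using support_extend[OF Cons.prems(1)] Cons.prems(2) by auto
  have "v a * mixed V c vs (add_mset a m) > 0"
    using Cons.prems a by (intro mult_pos_pos Cons.IH) auto
  moreover have "v b * mixed V c vs (add_mset b m) \<ge> 0" if "b \<in> V" for b
    using that Cons.prems(3) by (intro mult_nonneg_nonneg mixed_nonneg nonneg) (auto simp: less_imp_le)
  ultimately show ?case using a finite_V by (auto intro: sum_pos2)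
qed (auto intro: pos)

lemma mixed_zero: "\<not> P m \<Longrightarrow> size m + length vs = d \<Longrightarrow> mixed V c vs m = 0"
  by (rule mixed_zero_outside_support[where P = P, OF zero support_mono])

text \<open>Fixing one index of the third-derivative tensor trades the direction \<open>v\<close>
  for a variable \<open>i\<close>. The induction hypothesis at \<open>add_mset i m\<close> thus
  makes every slice hyperbolic, and \<open>hyperbolic_step\<close> recombines the slices along
  \<open>v\<close>.\<close>

theorem hyperbolic_mixed:
  assumes "size m + length vs + 2 = d" "set_mset m \<subseteq> V"
    and "\<And>v a. v \<in> set vs \<Longrightarrow> a \<in> V \<Longrightarrow> v a > 0"
  shows "hyperbolic V (\<lambda>i j. mixed V c vs (add_mset i (add_mset j m)))"
  using assms
proof (induction vs arbitrary: m)
  case Nil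
  then show ?case using base by simp
next
  case (Cons v vs)
  let ?T = "\<lambda>k i j. mixed V c vs (add_mset k (add_mset i (add_mset j m)))"
  \<comment> \<open>The positive entries of the contracted form are exactly those allowed by
    \<open>P\<close>, so that connectedness becomes a combinatorial condition.\<close>
  have iff: "mixed V c (v # vs) (add_mset i (add_mset j m)) > 0 \<longleftrightarrow> P (add_mset i (add_mset j m))" for i j
    using mixed_pos[of "add_mset i (add_mset j m)" "v # vs"] mixed_zero[of "add_mset i (add_mset j m)" "v # vs"]
      Cons.prems by fastforce
  then have iff': "0 < (\<Sum>l\<in>V. v l * ?T l i j) \<longleftrightarrow> P (add_mset i (add_mset j m))" for i j by simp
  have "hyperbolic V (\<lambda>i j. \<Sum>k\<in>V. v k * ?T k i j)"
  proof (rule hyperbolic_step[OF finite_V])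
    show "?T i j k = ?T j i k" for i j k by (simp add: add_mset_commute)
    show "?T i j k = ?T i k j" for i j k by (simp add: add_mset_commute)
    show "?T i j k \<ge> 0" for i j k
      using Cons.prems(3) by (intro mixed_nonneg nonneg) (auto simp: less_imp_le)
    show "v i > 0" if "i \<in> V" for i using that Cons.prems(3) by simp
    fix i assume "i \<in> V"
    then have "hyperbolic V (\<lambda>j k. mixed V c vs (add_mset j (add_mset k (add_mset i m))))"
      using Cons.prems by (intro Cons.IH) auto
    then show "hyperbolic V (?T i)" by (simp add: add_mset_commute)
  next
    fix i j assume ij: "i \<in> V" "j \<in> V"
      and "\<exists>k\<in>V. 0 < (\<Sum>l\<in>V. v l * ?T l i k)" "\<exists>k\<in>V. 0 < (\<Sum>l\<in>V. v l * ?T l j k)"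
    then obtain k l where "P (add_mset k (add_mset i m))" "P (add_mset l (add_mset j m))"
      unfolding iff' by (metis add_mset_commute)
    then have "P (add_mset i m)" "P (add_mset j m)"
      using support_mono by blast+
    then have "P (add_mset i (add_mset j m)) \<or>
      (\<exists>k\<in>V. P (add_mset i (add_mset k m)) \<and> P (add_mset k (add_mset j m)))"
      using ij Cons.prems by (intro support_connected) auto
    then show "0 < (\<Sum>l\<in>V. v l * ?T l i j) \<or>
      (\<exists>k\<in>V. 0 < (\<Sum>l\<in>V. v l * ?T l i k) \<and> 0 < (\<Sum>l\<in>V. v l * ?T l k j))"
      unfolding iff' .
  qed
  then show ?case by simp
qed

end

text \<open>The inequality is closed, so it passes to the limit even though the coefficients
  \<open>c\<close> need not be positive on \<open>P\<close>.\<close>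

theorem alexandrov_fenchel_limit:
  fixes C :: "real \<Rightarrow> 'v multiset \<Rightarrow> real"
  assumes C: "\<And>q. 0 < q \<Longrightarrow> q < 1 \<Longrightarrow> lorentzian_coeffs V d (C q) P"
    and lim: "\<And>m. ((\<lambda>q. C q m) \<longlongrightarrow> c m) (at_right 0)"
    and len: "length vs + 2 = d"
    and vs: "\<And>v a. v \<in> set vs \<Longrightarrow> a \<in> V \<Longrightarrow> v a \<ge> 0"
    and x: "\<And>a. a \<in> V \<Longrightarrow> x a \<ge> 0" and y: "\<And>a. a \<in> V \<Longrightarrow> y a \<ge> 0"
  shows "mixed V c (x # x # vs) {#} * mixed V c (y # y # vs) {#} \<le> (mixed V c (x # y # vs) {#})\<^sup>2"
proof -
  define B where "B = (\<lambda>q. bil V (\<lambda>a b. mixed V (C q) (map (\<lambda>v a. v a + q) vs) {#a, b#}))"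
  have B_lim: "((\<lambda>q. B q x y) \<longlongrightarrow> mixed V c (x # y # vs) {#}) (at_right 0)" for x y
    unfolding B_def mixed_Cons_Cons bil_def by (intro tendsto_intros tendsto_mixed lim)
  have ev: "\<forall>\<^sub>F q in at_right 0. B q x x * B q y y \<le> (B q x y)\<^sup>2"
  proof -
    have "B q x x * B q y y \<le> (B q x y)\<^sup>2" if q: "0 < q" "q < 1" for q
    proof -
      interpret lorentzian_coeffs V d "C q" P by (rule C[OF q])
      have H: "hyperbolic V (\<lambda>a b. mixed V (C q) (map (\<lambda>v a. v a + q) vs) {#a, b#})"
        using hyperbolic_mixed[of "{#}" "map (\<lambda>v a. v a + q) vs"] len vs q by (force simp: add_nonneg_pos)
      \<comment> \<open>\<open>hyperbolic\<close> speaks only of positive values at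
        \<open>y\<close>; if the value is zero, so is the left side.\<close>
      have "B q y y \<ge> 0"
        unfolding B_def bil_def using q vs y
        by (intro sum_nonneg mult_nonneg_nonneg mixed_nonneg nonneg) (auto simp: less_imp_le)
      then show ?thesis using H unfolding hyperbolic_def B_def
        by (metis less_eq_real_def mult_zero_right zero_le_power2)
    qed
    then show ?thesis
      unfolding eventually_at_right_field by (intro exI[of _ 1]) auto
  qed
  have "trivial_limit (at_right (0::real)) = False" by simp
  then show ?thesis
    using tendsto_le[OF _ tendsto_power[OF B_lim[of x y]] tendsto_mult[OF B_lim[of x x] B_lim[of y y]] ev]
    by blast
qed

section \<open>Second-order condition for one factor\<close>

text \<open>With \<open>s\<close> the total, the form is
  \<open>s\<^sup>2 - q * A - (1 - q) * B\<close>, where \<open>A\<close> sums the squares of the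
  entries and \<open>B\<close> the squares of the class totals. There are at most
  \<open>card X\<close> classes, so by Cauchy--Schwarz both \<open>A\<close> and \<open>B\<close>
  are at least \<open>s\<^sup>2 / card X\<close>.\<close>

lemma class_quadratic_form_le:
  fixes z :: "'a \<Rightarrow> real" and cls :: "'a \<Rightarrow> 'b"
  assumes fin: "finite X" and q: "0 \<le> q" "q \<le> 1"
  shows "(\<Sum>i\<in>X. \<Sum>j\<in>X. (if i = j then 0 else if cls i = cls j then q else 1) * (z i * z j))
      \<le> (1 - 1 / card X) * (\<Sum>i\<in>X. z i)\<^sup>2"
proof (cases "X = {}")
  case False
  let ?s = "\<Sum>i\<in>X. z i" and ?A = "\<Sum>i\<in>X. (z i)\<^sup>2"
  let ?B = "\<Sum>i\<in>X. \<Sum>j\<in>X. (if cls i = cls j then z i * z j else 0)"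
  have card: "card X > 0" using fin False by (simp add: card_gt_0_iff)
  have "?A = (\<Sum>i\<in>X. \<Sum>j\<in>X. (if i = j then z i * z j else 0))"
    using fin by (simp add: power2_eq_square)
  moreover have "?s\<^sup>2 = (\<Sum>i\<in>X. \<Sum>j\<in>X. z i * z j)"
    by (simp add: power2_eq_square sum_product)
  ultimately have "?s\<^sup>2 - q * ?A - (1 - q) * ?B =
    (\<Sum>i\<in>X. \<Sum>j\<in>X. z i * z j - q * (if i = j then z i * z j else 0) - (1 - q) * (if cls i = cls j then z i * z j else 0))"
    by (simp only: sum_subtractf sum_distrib_left)
  also have "\<dots> = (\<Sum>i\<in>X. \<Sum>j\<in>X. (if i = j then 0 else if cls i = cls j then q else 1) * (z i * z j))"
    by (intro sum.cong refl) (auto simp: algebra_simps)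
  finally have eq: "(\<Sum>i\<in>X. \<Sum>j\<in>X. (if i = j then 0 else if cls i = cls j then q else 1) * (z i * z j))
     = ?s\<^sup>2 - q * ?A - (1 - q) * ?B" by simp
  have A: "?s\<^sup>2 / card X \<le> ?A"
    using sum_squared_le_sum_of_squares[of z X] card fin by (simp add: field_simps)
  let ?S = "\<lambda>c. \<Sum>i\<in>{i \<in> X. cls i = c}. z i"
  have "?B = (\<Sum>c\<in>cls ` X. \<Sum>i\<in>{i \<in> X. cls i = c}. \<Sum>j\<in>X. (if cls i = cls j then z i * z j else 0))"
    by (rule sum.image_gen[OF fin])
  also have "\<dots> = (\<Sum>c\<in>cls ` X. (?S c)\<^sup>2)"
  proof (intro sum.cong refl)
    fix c
    have "(\<Sum>i\<in>{i \<in> X. cls i = c}. \<Sum>j\<in>X. (if cls i = cls j then z i * z j else 0)) =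
       (\<Sum>i\<in>{i \<in> X. cls i = c}. \<Sum>j\<in>{i \<in> X. cls i = c}. z i * z j)"
      using fin by (intro sum.cong refl sum.mono_neutral_cong_right) auto
    then show "(\<Sum>i\<in>{i \<in> X. cls i = c}. \<Sum>j\<in>X. (if cls i = cls j then z i * z j else 0)) = (?S c)\<^sup>2"
      by (simp add: power2_eq_square sum_product)
  qed
  finally have B: "?B = (\<Sum>c\<in>cls ` X. (?S c)\<^sup>2)" .
  have "?s = (\<Sum>c\<in>cls ` X. ?S c)" by (rule sum.image_gen[OF fin])
  then have "?s\<^sup>2 \<le> ?B * card (cls ` X)"
    using sum_squared_le_sum_of_squares[of ?S "cls ` X"] fin by (simp add: B)
  also have "\<dots> \<le> ?B * card X"
    unfolding B using fin by (intro mult_left_mono sum_nonneg) (auto simp: card_image_le)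
  finally have "?s\<^sup>2 / card X \<le> ?B" using card by (simp add: field_simps)
  then have "q * (?s\<^sup>2 / card X) + (1 - q) * (?s\<^sup>2 / card X) \<le> q * ?A + (1 - q) * ?B"
    using A q by (intro add_mono mult_left_mono) auto
  moreover have "q * (?s\<^sup>2 / card X) + (1 - q) * (?s\<^sup>2 / card X) = ?s\<^sup>2 / card X"
    by (simp only: flip: distrib_right) simp
  ultimately show ?thesis unfolding eq by (simp add: left_diff_distrib)
qed simp

text \<open>
  The polynomial \<open>\<Sum>S. u S * (\<Prod>e\<in>S. x e) * z ^ (n - card S)\<close>, with \<open>None\<close> for the variable \<open>z\<close> and
  \<open>Some e\<close> for \<open>x e\<close>.
\<close>
definition coef :: "nat \<Rightarrow> ('a set \<Rightarrow> real) \<Rightarrow> 'a option multiset \<Rightarrow> real" where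
  "coef n u M = (if size M = n \<and> (\<forall>e. count M (Some e) \<le> 1)
                 then fact (count M None) * u {e. Some e \<in># M} else 0)"

text \<open>
  After rescaling the variables by \<open>u (insert i T) / u T\<close>, the second-order part of \<open>u\<close> at \<open>T\<close> has entry \<open>q\<close>
  for parallel and \<open>1\<close> for non-parallel pairs. Loops have to form classes of their own.
\<close>
definition parallel_weight :: "'a set \<Rightarrow> real \<Rightarrow> ('a set \<Rightarrow> real) \<Rightarrow> bool" where
  "parallel_weight E q u \<longleftrightarrow> (\<forall>S. u S > 0) \<and>
     (\<forall>T \<subseteq> E. \<exists>cls :: 'a \<Rightarrow> 'a set. \<forall>i\<in>E - T. \<forall>j\<in>E - T. i \<noteq> j \<longrightarrow>
        u (insert i (insert j T)) * u T
          = (if cls i = cls j then q else 1) * (u (insert i T) * u (insert j T)))"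

lemma size_eq_count_None_plus:
  assumes "\<forall>e. count M (Some e) \<le> 1"
  shows "size M = count M None + card {e. Some e \<in># M}"
proof -
  let ?T = "{e. Some e \<in># M}"
  have "set_mset M \<subseteq> insert None (Some ` ?T)"
  proof
    fix x assume "x \<in># M"
    then show "x \<in> insert None (Some ` ?T)" by (cases x) auto
  qed
  moreover have "Some ` ?T \<subseteq> set_mset M" by auto
  then have finT: "finite ?T" using finite_subset finite_imageD by (metis finite_set_mset inj_Some inj_on_subset subset_UNIV)
  ultimately have "size M = (\<Sum>x\<in>insert None (Some ` ?T). count M x)"
    unfolding size_multiset_overloaded_eq by (intro sum.mono_neutral_left) (auto simp: not_in_iff)
  also have "\<dots> = count M None + (\<Sum>e\<in>?T. count M (Some e))"
    using finT by (subst sum.insert) (auto simp: sum.reindex)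
  also have "(\<Sum>e\<in>?T. count M (Some e)) = (\<Sum>e\<in>?T. 1)"
  proof (intro sum.cong refl)
    fix e assume "e \<in> ?T"
    then have "count M (Some e) > 0" by simp
    then show "count M (Some e) = 1" using assms by (metis One_nat_def Suc_leI le_antisym)
  qed
  finally show ?thesis by simp
qed

text \<open>A repeated variable in \<open>M\<close> makes the form zero. Otherwise it lives on
  \<open>None\<close> and the set \<open>X\<close> of elements not yet used; eliminating the
  \<open>None\<close> coordinate leaves precisely the form bounded in
  \<open>class_quadratic_form_le\<close>.\<close>

lemma hyperbolic_coef:
  assumes fin: "finite E" and u: "parallel_weight E q u" and q: "0 < q" "q < 1"
    and size: "size M + 2 = card E" and M: "set_mset M \<subseteq> insert None (Some ` E)"
  shows "hyperbolic (insert None (Some ` E)) (\<lambda>a b. coef (card E) u (add_mset a (add_mset b M)))"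
    (is "hyperbolic ?V ?Q")
proof (cases "\<forall>e. count M (Some e) \<le> 1")
  case False
  then obtain e where e: "count M (Some e) > 1" by (auto simp: not_le)
  then have "count (add_mset a (add_mset b M)) (Some e) > 1" for a b
    by (rule less_le_trans) simp
  then have "?Q a b = 0" for a b unfolding coef_def by (metis not_le)
  then show ?thesis by (simp add: hyperbolic_def bil_def)
next
  case simple: True
  define T where "T = {e. Some e \<in># M}"
  define X where "X = E - T"
  define m where "m = count M None + 2"
  have TE: "T \<subseteq> E" using M by (auto simp: T_def)
  have finT: "finite T" and finX: "finite X" using TE fin finite_subset by (auto simp: X_def)
  have "card X = m"
    using size size_eq_count_None_plus[OF simple] TE finT by (simp add: X_def m_def T_def card_Diff_subset)
  obtain cls :: "'a \<Rightarrow> 'a set" where cls: "\<And>i j. i \<in> X \<Longrightarrow> j \<in> X \<Longrightarrow> i \<noteq> j \<Longrightarrow>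
      u (insert i (insert j T)) * u T = (if cls i = cls j then q else 1) * (u (insert i T) * u (insert j T))"
    using u TE unfolding parallel_weight_def X_def by metis
  have up: "u S > 0" for S using u by (simp add: parallel_weight_def)
  have cT: "count M (Some e) = (if e \<in> T then 1 else 0)" for e
    using simple unfolding T_def by (auto simp: not_in_iff) (metis One_nat_def Suc_leI count_greater_zero_iff le_antisym)
  define N where "N = real (m - 1)"
  define F where "F = (fact (m - 2) :: real)"
  have fact1: "(fact (m - 1) :: real) = N * F" and fact0: "(fact m :: real) = (N + 1) * N * F"
    unfolding N_def F_def m_def by simp_all
  have QNN: "?Q None None = (N + 1) * N * F * u T"
  proof -
    have "count (add_mset None (add_mset None M)) None = m" by (simp add: m_def)
    then show ?thesis using size simple fact0 by (simp add: coef_def T_def)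
  qed
  have QNS: "?Q None (Some i) = N * F * u (insert i T)" if "i \<in> X" for i
  proof -
    have "{e. Some e \<in># add_mset None (add_mset (Some i) M)} = insert i T" by (auto simp: T_def)
    moreover have "\<forall>e. count (add_mset None (add_mset (Some i) M)) (Some e) \<le> 1"
      using that cT by (auto simp: X_def)
    moreover have "count (add_mset None (add_mset (Some i) M)) None = m - 1" by (simp add: m_def)
    ultimately show ?thesis using size fact1 by (simp add: coef_def)
  qed
  have QNS0: "?Q None (Some i) = 0" if "i \<in> T" for i
  proof -
    have "count (add_mset None (add_mset (Some i) M)) (Some i) > 1" using that cT by simp
    then show ?thesis unfolding coef_def by (metis not_le)
  qed
  have QSN: "?Q (Some i) None = ?Q None (Some i)" for i by (simp add: add_mset_commute)
  have QSS: "?Q (Some i) (Some j) = F * u (insert i (insert j T))" if "i \<in> X" "j \<in> X" "i \<noteq> j" for i j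
  proof -
    have "{e. Some e \<in># add_mset (Some i) (add_mset (Some j) M)} = insert i (insert j T)" by (auto simp: T_def)
    moreover have "\<forall>e. count (add_mset (Some i) (add_mset (Some j) M)) (Some e) \<le> 1"
      using that cT by (auto simp: X_def)
    moreover have "count (add_mset (Some i) (add_mset (Some j) M)) None = m - 2" by (simp add: m_def)
    ultimately show ?thesis using size by (simp add: coef_def F_def)
  qed
  have QSS0: "?Q (Some i) (Some j) = 0" if "i \<in> T \<or> j \<in> T \<or> i = j" for i j
  proof -
    have "count (add_mset (Some i) (add_mset (Some j) M)) (Some i) > 1 \<or>
      count (add_mset (Some i) (add_mset (Some j) M)) (Some j) > 1" using that cT by auto
    then show ?thesis unfolding coef_def by (metis not_le)
  qed
  \<comment> \<open>Up to the factor \<open>N * F\<close> this is the row of \<open>?Q\<close> at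
    \<open>None\<close>, so its kernel is the orthogonal complement of that variable with respect to
    the form.\<close>
  define l where "l = (\<lambda>a. case a of None \<Rightarrow> (N + 1) * u T | Some i \<Rightarrow> if i \<in> X then u (insert i T) else 0)"
  show ?thesis
  proof (rule hyperbolicI[where l = l])
    show "?Q a b = ?Q b a" for a b by (simp add: add_mset_commute)
  next
    fix x :: "'a option \<Rightarrow> real" assume l0: "(\<Sum>a\<in>?V. l a * x a) = 0"
    define z where "z = (\<lambda>i. u (insert i T) * x (Some i))"
    define s where "s = (\<Sum>i\<in>X. z i)"
    define w where "w = u T * x None"
    have sumV: "(\<Sum>a\<in>?V. f a) = f None + (\<Sum>i\<in>E. f (Some i))" for f :: "'a option \<Rightarrow> real"
      using fin by (subst sum.insert) (auto simp: sum.reindex)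
    have sumX: "(\<Sum>i\<in>E. f i) = (\<Sum>i\<in>X. f i)" if "\<And>i. i \<in> T \<Longrightarrow> f i = 0" for f :: "'a \<Rightarrow> real"
      using that fin by (intro sum.mono_neutral_right) (auto simp: X_def)
    have "(\<Sum>a\<in>?V. l a * x a) = (N + 1) * w + (\<Sum>i\<in>E. l (Some i) * x (Some i))"
      by (simp add: sumV l_def w_def)
    also have "(\<Sum>i\<in>E. l (Some i) * x (Some i)) = (\<Sum>i\<in>X. l (Some i) * x (Some i))"
      by (rule sumX) (simp add: l_def X_def)
    also have "\<dots> = s" unfolding s_def by (intro sum.cong) (auto simp: l_def z_def)
    finally have ws: "(N + 1) * w = - s" using l0 by simp
    let ?b = "\<lambda>i j. (if i = j then 0 else if cls i = cls j then q else 1) * (z i * z j)"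
    let ?c = "\<lambda>a b. x a * ?Q a b * x b"
    have "bil ?V ?Q x x = ?c None None + (\<Sum>j\<in>E. ?c None (Some j)) +
        (\<Sum>i\<in>E. ?c (Some i) None) + (\<Sum>i\<in>E. \<Sum>j\<in>E. ?c (Some i) (Some j))"
      unfolding bil_def by (simp only: sumV sum.distrib add.assoc)
    also have "(\<Sum>i\<in>E. ?c (Some i) None) = (\<Sum>j\<in>E. ?c None (Some j))"
      by (simp only: QSN mult.commute mult.left_commute)
    also have "(\<Sum>j\<in>E. ?c None (Some j)) = (\<Sum>j\<in>X. ?c None (Some j))"
      by (rule sumX) (simp add: QNS0)
    also have "(\<Sum>i\<in>E. \<Sum>j\<in>E. ?c (Some i) (Some j)) = (\<Sum>i\<in>X. \<Sum>j\<in>E. ?c (Some i) (Some j))"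
      by (rule sumX) (simp add: QSS0)
    also have "\<dots> = (\<Sum>i\<in>X. \<Sum>j\<in>X. ?c (Some i) (Some j))"
      by (intro sum.cong[OF refl] sumX) (simp add: QSS0)
    finally have "u T * bil ?V ?Q x x = u T * ?c None None + 2 * (\<Sum>j\<in>X. u T * ?c None (Some j)) +
        (\<Sum>i\<in>X. \<Sum>j\<in>X. u T * ?c (Some i) (Some j))"
      by (simp add: sum_distrib_left algebra_simps)
    also have "u T * ?c None None = F * ((N + 1) * N * w\<^sup>2)"
      by (simp add: QNN w_def power2_eq_square)
    also have "(\<Sum>j\<in>X. u T * ?c None (Some j)) = F * (N * w * s)"
      unfolding s_def sum_distrib_left by (intro sum.cong refl) (simp add: QNS z_def w_def)
    also have "(\<Sum>i\<in>X. \<Sum>j\<in>X. u T * ?c (Some i) (Some j)) = F * (\<Sum>i\<in>X. \<Sum>j\<in>X. ?b i j)"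
      unfolding sum_distrib_left
    proof (intro sum.cong refl)
      fix i j assume ij: "i \<in> X" "j \<in> X"
      show "u T * ?c (Some i) (Some j) = F * ?b i j"
      proof (cases "i = j")
        case True then show ?thesis using QSS0[of i j] by simp
      next
        case False
        have "u T * ?c (Some i) (Some j) = F * (u (insert i (insert j T)) * u T) * (x (Some i) * x (Some j))"
          using QSS[OF ij False] by simp
        also have "\<dots> = F * ?b i j" unfolding cls[OF ij False] using False by (simp add: z_def)
        finally show ?thesis .
      qed
    qed
    also have "F * ((N + 1) * N * w\<^sup>2) + 2 * (F * (N * w * s)) + F * (\<Sum>i\<in>X. \<Sum>j\<in>X. ?b i j)
       = F * ((\<Sum>i\<in>X. \<Sum>j\<in>X. ?b i j) + (N * w) * ((N + 1) * w) + 2 * (N * w * s))"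
      by (simp add: algebra_simps power2_eq_square)
    also have "\<dots> = F * ((\<Sum>i\<in>X. \<Sum>j\<in>X. ?b i j) + N * w * s)"
      unfolding ws by (simp add: algebra_simps)
    also have "\<dots> \<le> F * 0"
    proof (rule mult_left_mono)
      have N: "N + 1 = card X" using \<open>card X = m\<close> by (simp add: N_def m_def)
      \<comment> \<open>As \<open>N + 1 = card X\<close>, the bound is cancelled exactly by the
        contribution \<open>N * w * s\<close> of the homogenizing variable.\<close>
      have "(\<Sum>i\<in>X. \<Sum>j\<in>X. ?b i j) \<le> (1 - 1 / (N + 1)) * s\<^sup>2"
        unfolding N s_def using q by (intro class_quadratic_form_le finX) auto
      moreover have "N + 1 > 0" by (simp add: N_def)
      then have w: "w = - s / (N + 1)" using ws by (simp add: field_simps)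
      have "N * w * s = - ((1 - 1 / (N + 1)) * s\<^sup>2)"
        unfolding w using \<open>N + 1 > 0\<close> by (simp add: field_simps power2_eq_square)
      ultimately show "(\<Sum>i\<in>X. \<Sum>j\<in>X. ?b i j) + N * w * s \<le> 0" by linarith
    qed (simp add: F_def)
    finally show "bil ?V ?Q x x \<le> 0" using up[of T] by (simp add: mult_le_0_iff)
  qed
qed

section \<open>Weights from matroid ranks\<close>

text \<open>The part of the rank axioms that involves only one- and two-element extensions.\<close>
definition local_rank :: "'a set \<Rightarrow> ('a set \<Rightarrow> nat) \<Rightarrow> bool" where
  "local_rank E r \<longleftrightarrow>
     (\<forall>T \<subseteq> E. \<forall>i\<in>E. r T \<le> r (insert i T) \<and> r (insert i T) \<le> r T + 1) \<and>
     (\<forall>T \<subseteq> E. \<forall>i\<in>E. \<forall>j\<in>E. r (insert i T) = r T \<longrightarrow> r (insert j T) = r T \<longrightarrow>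
        r (insert i (insert j T)) = r T)"

text \<open>After contracting \<open>T\<close>, two non-loops are parallel when adding both raises
  the rank only by one. This is an equivalence relation, and its classes record the defect of
  modularity.\<close>

lemma local_rank_parallel_classes:
  assumes r: "local_rank E r" and TE: "T \<subseteq> E"
  shows "\<exists>cls :: 'a \<Rightarrow> 'a set. \<forall>i\<in>E - T. \<forall>j\<in>E - T. i \<noteq> j \<longrightarrow>
    r (insert i T) + r (insert j T) = r (insert i (insert j T)) + r T + (if cls i = cls j then 1 else 0)"
proof -
  have step: "r S \<le> r (insert i S)" "r (insert i S) \<le> r S + 1" if "S \<subseteq> E" "i \<in> E" for S i
    using r that unfolding local_rank_def by blast+
  have flat: "r (insert i (insert j S)) = r S"
    if "S \<subseteq> E" "i \<in> E" "j \<in> E" "r (insert i S) = r S" "r (insert j S) = r S" for S i j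
    using r that unfolding local_rank_def by blast
  define R where "R = (\<lambda>i k. r (insert k T) = r T + 1 \<and> r (insert i (insert k T)) = r T + 1)"
  \<comment> \<open>A loop gets the class consisting of itself. It differs from the class of any
    other element, because a non-loop belongs to its own class.\<close>
  define cls where "cls = (\<lambda>i. if r (insert i T) = r T then {i} else {k \<in> E. R i k})"
  have R_trans: "R i l" if "R i k" "R k l" "i \<in> E" "k \<in> E" "l \<in> E" for i k l
  proof -
    have k: "r (insert k T) = r T + 1" "r (insert i (insert k T)) = r T + 1" "r (insert l (insert k T)) = r T + 1"
      using that by (auto simp: R_def insert_commute)
    \<comment> \<open>Over \<open>insert k T\<close> both \<open>i\<close> and \<open>l\<close> are
      loops, so adding them together does not raise the rank either.\<close>
    have "r (insert i (insert l (insert k T))) = r T + 1"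
      using flat[of "insert k T" i l] k TE that by simp
    moreover have "r (insert i (insert l T)) \<le> r (insert k (insert i (insert l T)))"
      using step(1)[of "insert i (insert l T)" k] TE that by simp
    moreover have "r (insert l T) \<le> r (insert i (insert l T))"
      using step(1)[of "insert l T" i] TE that by simp
    ultimately show ?thesis using that by (simp add: R_def insert_commute)
  qed
  have "r (insert i T) + r (insert j T) = r (insert i (insert j T)) + r T + (if cls i = cls j then 1 else 0)"
    if i: "i \<in> E - T" and j: "j \<in> E - T" and ij: "i \<noteq> j" for i j
  proof -
    have self: "R k k" if "k \<in> E" "r (insert k T) \<noteq> r T" for k
      using step[of T k] that TE by (simp add: R_def)
    have bounds: "r (insert i T) \<le> r (insert i (insert j T))" "r (insert j T) \<le> r (insert i (insert j T))"
      "r (insert i (insert j T)) \<le> r (insert i T) + 1" "r (insert i (insert j T)) \<le> r (insert j T) + 1"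
      using step[of "insert i T" j] step[of "insert j T" i] i j TE by (auto simp: insert_commute)
    have bounds': "r T \<le> r (insert i T)" "r (insert i T) \<le> r T + 1" "r T \<le> r (insert j T)" "r (insert j T) \<le> r T + 1"
      using step[of T i] step[of T j] i j TE by auto
    show ?thesis
    proof (cases "r (insert i T) = r T \<or> r (insert j T) = r T")
      case True
      have "cls i \<noteq> cls j" using True ij self[of i] self[of j] i j unfolding cls_def by (auto split: if_splits)
      moreover have "r (insert i (insert j T)) + r T = r (insert i T) + r (insert j T)"
        using True bounds bounds' flat[of T i j] TE i j by (cases "r (insert i T) = r (insert j T)") auto
      ultimately show ?thesis by simp
    next
      case False
      then have nl: "r (insert i T) = r T + 1" "r (insert j T) = r T + 1" using bounds' by auto
      have sym: "R i k \<longleftrightarrow> R k i" if "r (insert k T) = r T + 1" for k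
        using nl that by (simp add: R_def insert_commute)
      have "cls i = cls j \<longleftrightarrow> R i j"
      proof
        assume "cls i = cls j"
        then have "j \<in> cls i" using False self[of j] j by (auto simp: cls_def)
        then show "R i j" using False by (simp add: cls_def)
      next
        assume *: "R i j"
        then have "R j i" using nl by (simp add: R_def insert_commute)
        then have "R i k \<longleftrightarrow> R j k" if "k \<in> E" for k
          using * R_trans that i j by blast
        then show "cls i = cls j" using False by (auto simp: cls_def)
      qed
      moreover have "R i j \<longleftrightarrow> r (insert i (insert j T)) = r T + 1" using nl by (simp add: R_def)
      ultimately show ?thesis using nl bounds by auto
    qed
  qed
  then show ?thesis by blast
qed

text \<open>For a matroid rank \<open>r\<close> this function is the rank of the dual matroid plus
  the constant \<open>r E\<close>.\<close>

lemma local_rank_dual: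
  assumes r: "local_rank E r" and fin: "finite E"
  shows "local_rank E (\<lambda>S. card S + r (E - S))"
proof -
  have step: "r S \<le> r (insert i S)" "r (insert i S) \<le> r S + 1" if "S \<subseteq> E" "i \<in> E" for S i
    using r that unfolding local_rank_def by blast+
  have flat: "r (insert i (insert j S)) = r S"
    if "S \<subseteq> E" "i \<in> E" "j \<in> E" "r (insert i S) = r S" "r (insert j S) = r S" for S i j
    using r that unfolding local_rank_def by blast
  have ins: "E - T = insert i (E - insert i T)" if "i \<in> E" "i \<notin> T" for T i using that by auto
  show ?thesis unfolding local_rank_def
  proof (intro conjI allI impI ballI)
    fix T i assume T: "T \<subseteq> E" and i: "i \<in> E"
    have finT: "finite T" using T fin finite_subset by blast
    have "card T + r (E - T) \<le> card (insert i T) + r (E - insert i T) \<and>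
      card (insert i T) + r (E - insert i T) \<le> card T + r (E - T) + 1"
    proof (cases "i \<in> T")
      case True then show ?thesis by (simp add: insert_absorb)
    next
      case False
      then show ?thesis using step[of "E - insert i T" i] ins[OF i False] i finT by auto
    qed
    then show "card T + r (E - T) \<le> card (insert i T) + r (E - insert i T)"
      "card (insert i T) + r (E - insert i T) \<le> card T + r (E - T) + 1" by auto
  next
    fix T i j assume T: "T \<subseteq> E" and i: "i \<in> E" and j: "j \<in> E"
      and ri: "card (insert i T) + r (E - insert i T) = card T + r (E - T)"
      and rj: "card (insert j T) + r (E - insert j T) = card T + r (E - T)"
    have finT: "finite T" using T fin finite_subset by blast
    show "card (insert i (insert j T)) + r (E - insert i (insert j T)) = card T + r (E - T)"
    proof (cases "i \<in> T \<or> j \<in> T \<or> i = j")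
      case True
      then show ?thesis using ri rj by (auto simp: insert_absorb)
    next
      case False
      let ?Y = "E - insert i (insert j T)"
      have Y: "insert i ?Y = E - insert j T" "insert j ?Y = E - insert i T" "insert i (insert j ?Y) = E - T"
        using False i j by auto
      have "r (E - insert i T) + 1 = r (E - T)" "r (E - insert j T) + 1 = r (E - T)"
        using ri rj False finT by auto
      moreover have "r ?Y \<le> r (E - insert i T)" "r (E - insert i T) \<le> r ?Y + 1"
        using step[of ?Y j] j Y by auto
      \<comment> \<open>If removing the second element did not lower the rank again, both
        \<open>i\<close> and \<open>j\<close> would be loops over \<open>?Y\<close>, and
        \<open>flat\<close> would contradict the first drop.\<close>
      moreover have "\<not> (r (E - insert i T) = r ?Y \<and> r (E - insert j T) = r ?Y \<and> r (E - T) \<noteq> r ?Y)"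
        using flat[of ?Y i j] i j Y by auto
      ultimately show ?thesis using False finT by auto
    qed
  qed
qed

text \<open>The weight is \<open>k * l ^ card S / q ^ r S\<close>, written without division. In the
  identity to be shown both sides involve the same total cardinality, so \<open>k\<close> and
  \<open>l\<close> cancel and the power of \<open>q\<close> left over is the class defect of the
  rank.\<close>

lemma parallel_weightI:
  assumes r: "local_rank E r" and fin: "finite E" and q: "q > 0" and l: "l > 0"
    and pos: "\<And>S. u S > 0"
    and u: "\<And>S. S \<subseteq> E \<Longrightarrow> u S * q ^ r S = k * l ^ card S"
  shows "parallel_weight E q u"
  unfolding parallel_weight_def
proof (intro conjI allI impI)
  show "u S > 0" for S by (rule pos)
  fix T assume TE: "T \<subseteq> E"
  obtain cls :: "'a \<Rightarrow> 'a set" where cls: "\<And>i j. i \<in> E - T \<Longrightarrow> j \<in> E - T \<Longrightarrow> i \<noteq> j \<Longrightarrow>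
    r (insert i T) + r (insert j T) = r (insert i (insert j T)) + r T + (if cls i = cls j then 1 else 0)"
    using local_rank_parallel_classes[OF r TE] by metis
  have finT: "finite T" using TE fin finite_subset by blast
  have "u (insert i (insert j T)) * u T = (if cls i = cls j then q else 1) * (u (insert i T) * u (insert j T))"
    if i: "i \<in> E - T" and j: "j \<in> E - T" and ij: "i \<noteq> j" for i j
  proof -
    let ?e = "r (insert i (insert j T)) + r T"
    have "u (insert i (insert j T)) * u T * q ^ ?e =
       (u (insert i (insert j T)) * q ^ r (insert i (insert j T))) * (u T * q ^ r T)"
      by (simp add: power_add)
    also have "\<dots> = k * l ^ (card T + 2) * (k * l ^ card T)"
      using u[of "insert i (insert j T)"] u[of T] i j ij TE finT by simp
    also have "\<dots> = (u (insert i T) * q ^ r (insert i T)) * (u (insert j T) * q ^ r (insert j T))"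
      using u[of "insert i T"] u[of "insert j T"] i j TE finT by simp
    also have "\<dots> = u (insert i T) * u (insert j T) * q ^ (r (insert i T) + r (insert j T))"
      by (simp add: power_add)
    also have "\<dots> = (if cls i = cls j then q else 1) * (u (insert i T) * u (insert j T)) * q ^ ?e"
      unfolding cls[OF i j ij] by (simp add: power_add)
    finally show ?thesis using q by simp
  qed
  then show "\<exists>cls :: 'a \<Rightarrow> 'a set. \<forall>i\<in>E - T. \<forall>j\<in>E - T. i \<noteq> j \<longrightarrow>
        u (insert i (insert j T)) * u T = (if cls i = cls j then q else 1) * (u (insert i T) * u (insert j T))"
    by blast
qed

definition rank_of :: "('a set \<Rightarrow> bool) \<Rightarrow> 'a set \<Rightarrow> nat" where
  "rank_of indep A = Max (card ` {I. I \<subseteq> A \<and> indep I})"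

context matroid
begin

lemma finite_indeps: "finite {I. I \<subseteq> A \<and> indep I}"
  by (rule finite_subset[of _ "Pow carrier"]) (use finite_carrier indep_subset_carrier in auto)

lemma card_le_rank_of: "I \<subseteq> A \<Longrightarrow> indep I \<Longrightarrow> card I \<le> rank_of indep A"
  unfolding rank_of_def using finite_indeps by (intro Max_ge) auto

lemma obtain_rank_of:
  obtains I where "I \<subseteq> A" "indep I" "card I = rank_of indep A"
proof -
  have "rank_of indep A \<in> card ` {I. I \<subseteq> A \<and> indep I}"
    unfolding rank_of_def using finite_indeps indep_empty by (intro Max_in) auto
  then show ?thesis using that by auto
qed

lemma finite_indep: "indep I \<Longrightarrow> finite I"
  using indep_subset_carrier finite_carrier finite_subset by blast

lemma rank_of_le_card: "finite A \<Longrightarrow> rank_of indep A \<le> card A"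
  using obtain_rank_of[of A] by (metis card_mono)

lemma rank_of_eq_card_iff: "finite A \<Longrightarrow> rank_of indep A = card A \<longleftrightarrow> indep A"
  using obtain_rank_of[of A] card_le_rank_of[of A A] rank_of_le_card[of A]
  by (metis card_subset_eq le_antisym order_refl)

lemma local_rank_rank_of: "local_rank carrier (rank_of indep)"
  unfolding local_rank_def
proof (intro conjI allI impI ballI)
  fix T i
  obtain I where I: "I \<subseteq> T" "indep I" "card I = rank_of indep T" by (rule obtain_rank_of)
  then show "rank_of indep T \<le> rank_of indep (insert i T)" using card_le_rank_of[of I "insert i T"] by auto
  obtain K where K: "K \<subseteq> insert i T" "indep K" "card K = rank_of indep (insert i T)" by (rule obtain_rank_of)
  have "card (K - {i}) \<le> rank_of indep T"
    using K indep_subset[of K "K - {i}"] by (intro card_le_rank_of) auto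
  then show "rank_of indep (insert i T) \<le> rank_of indep T + 1"
    using K card_Diff1_le[of K i] finite_indep[of K] by (cases "i \<in> K") (auto simp: card_Diff_singleton)
next
  fix T i j
  assume i: "rank_of indep (insert i T) = rank_of indep T" and j: "rank_of indep (insert j T) = rank_of indep T"
  obtain I where I: "I \<subseteq> T" "indep I" "card I = rank_of indep T" by (rule obtain_rank_of)
  obtain K where K: "K \<subseteq> insert i (insert j T)" "indep K" "card K = rank_of indep (insert i (insert j T))"
    by (rule obtain_rank_of)
  have "\<not> card I < card K"
  proof
    assume "card I < card K"
    then obtain x where x: "x \<in> K - I" "indep (insert x I)" using augment I K by blast
    have "card (insert x I) = card I + 1" using x finite_indep[OF I(2)] by simp
    \<comment> \<open>The augmenting element is a single one, so it can use at most one of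
      \<open>i\<close> and \<open>j\<close>, neither of which raises the rank.\<close>
    moreover have "insert x I \<subseteq> insert i T \<or> insert x I \<subseteq> insert j T" using x K I by auto
    then have "card (insert x I) \<le> rank_of indep T"
      using card_le_rank_of[OF _ x(2)] i j by metis
    ultimately show False using I by simp
  qed
  moreover have "card I \<le> rank_of indep (insert i (insert j T))" using I by (intro card_le_rank_of) auto
  ultimately show "rank_of indep (insert i (insert j T)) = rank_of indep T" using I K by simp
qed

lemma parallel_weight_nullity:
  assumes "0 < q"
  shows "parallel_weight carrier q (\<lambda>S. q ^ (card S - rank_of indep S))"
proof (rule parallel_weightI[OF local_rank_rank_of finite_carrier assms assms])
  fix S assume "S \<subseteq> carrier"
  then have "rank_of indep S \<le> card S" using finite_carrier finite_subset by (intro rank_of_le_card) blast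
  then show "q ^ (card S - rank_of indep S) * q ^ rank_of indep S = 1 * q ^ card S"
    by (simp flip: power_add)
qed (use assms in auto)

text \<open>The nullity of the complement is \<open>card carrier\<close> minus the function of
  \<open>local_rank_dual\<close>, whence the constants \<open>q ^ card carrier\<close> and
  \<open>1\<close>; for the nullity itself they are \<open>1\<close> and \<open>q\<close>.\<close>

lemma parallel_weight_conullity:
  assumes "0 < q"
  shows "parallel_weight carrier q (\<lambda>S. q ^ (card (carrier - S) - rank_of indep (carrier - S)))"
proof (rule parallel_weightI[OF local_rank_dual[OF local_rank_rank_of finite_carrier] finite_carrier assms zero_less_one])
  fix S assume S: "S \<subseteq> carrier"
  have "rank_of indep (carrier - S) \<le> card (carrier - S)" using finite_carrier by (intro rank_of_le_card) blast
  moreover have "card (carrier - S) + card S = card carrier"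
    using S finite_carrier by (metis add.commute card_mono card_Diff_subset finite_subset le_add_diff_inverse)
  ultimately show "q ^ (card (carrier - S) - rank_of indep (carrier - S)) * q ^ (card S + rank_of indep (carrier - S))
      = q ^ card carrier * 1 ^ card S"
    by (simp flip: power_add)
qed (use assms in auto)

end

section \<open>The product polynomial\<close>

definition lft :: "('b + 'c) multiset \<Rightarrow> 'b multiset" where
  "lft m = image_mset projl (filter_mset isl m)"

definition rgt :: "('b + 'c) multiset \<Rightarrow> 'c multiset" where
  "rgt m = image_mset projr (filter_mset (\<lambda>x. \<not> isl x) m)"

lemma lft_rgt_simps [simp]:
  "lft {#} = {#}" "rgt {#} = {#}"
  "lft (add_mset (Inl a) m) = add_mset a (lft m)" "lft (add_mset (Inr b) m) = lft m"
  "rgt (add_mset (Inl a) m) = rgt m" "rgt (add_mset (Inr b) m) = add_mset b (rgt m)"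
  by (simp_all add: lft_def rgt_def)

lemma count_lft [simp]: "count (lft m) a = count m (Inl a)"
proof (induction m)
  case (add x m) then show ?case by (cases x) auto
qed simp

lemma count_rgt [simp]: "count (rgt m) b = count m (Inr b)"
proof (induction m)
  case (add x m) then show ?case by (cases x) auto
qed simp

lemma size_lft_rgt: "size (lft m) + size (rgt m) = size m"
proof (induction m)
  case (add x m) then show ?case by (cases x) auto
qed simp

abbreviation vars :: "'a set \<Rightarrow> 'a option set" where
  "vars E \<equiv> insert None (Some ` E)"

abbreviation pair_vars :: "'a set \<Rightarrow> ('a option + 'a option) set" where
  "pair_vars E \<equiv> vars E <+> vars E"

definition pair_coef ::
  "nat \<Rightarrow> ('a set \<Rightarrow> real) \<Rightarrow> ('a set \<Rightarrow> real) \<Rightarrow> ('a option + 'a option) multiset \<Rightarrow> real" where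
  "pair_coef n u1 u2 m = coef n u1 (lft m) * coef n u2 (rgt m)"

text \<open>As the weights are positive, a derivative of one factor survives exactly when it is
  squarefree in the variables \<open>Some e\<close> and of order at most \<open>n\<close>; powers of
  \<open>None\<close> fill the remaining degree.\<close>

definition supp :: "nat \<Rightarrow> 'a option multiset \<Rightarrow> bool" where
  "supp n M \<longleftrightarrow> size M \<le> n \<and> (\<forall>e. count M (Some e) \<le> 1)"

lemma supp_add_None: "supp n M \<Longrightarrow> size M < n \<Longrightarrow> supp n (add_mset None M)"
  by (simp add: supp_def)

lemma supp_mono: "supp n (add_mset a M) \<Longrightarrow> supp n M"
  unfolding supp_def by (metis Suc_leD count_add_mset le_SucI le_trans order_refl size_add_mset)

lemma coef_nonneg: "(\<And>S. u S > 0) \<Longrightarrow> coef n u M \<ge> 0"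
  by (simp add: coef_def less_imp_le)

lemma coef_pos: "(\<And>S. u S > 0) \<Longrightarrow> size M = n \<Longrightarrow> supp n M \<Longrightarrow> coef n u M > 0"
  by (simp add: coef_def supp_def)

lemma coef_zero: "size M \<noteq> n \<or> \<not> supp n M \<Longrightarrow> coef n u M = 0"
  by (auto simp: coef_def supp_def)

lemma sum_Plus: "finite A \<Longrightarrow> finite B \<Longrightarrow> (\<Sum>x\<in>A <+> B. f x) = (\<Sum>a\<in>A. f (Inl a)) + (\<Sum>b\<in>B. f (Inr b))"
  by (simp add: sum.Plus)

lemma hyperbolic_Plus_left:
  assumes fin: "finite A" "finite B" and H: "hyperbolic A H" and k: "k \<ge> 0"
    and Q: "\<And>a a'. Q (Inl a) (Inl a') = k * H a a'" "\<And>b x. Q (Inr b) x = 0" "\<And>x b. Q x (Inr b) = 0"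
  shows "hyperbolic (A <+> B) Q"
proof -
  have eq: "bil (A <+> B) Q x y = k * bil A H (\<lambda>a. x (Inl a)) (\<lambda>a. y (Inl a))" for x y
    unfolding bil_def using fin Q by (simp add: sum_Plus sum_distrib_left algebra_simps)
  show ?thesis unfolding hyperbolic_def eq
  proof (intro allI impI)
    fix x y :: "'a + 'b \<Rightarrow> real"
    let ?b = "\<lambda>x y. bil A H (\<lambda>a. x (Inl a)) (\<lambda>a. y (Inl a))"
    assume "k * ?b y y > 0"
    then have "?b y y > 0" using k by (simp add: zero_less_mult_iff)
    then have "?b x x * ?b y y \<le> (?b x y)\<^sup>2" using H unfolding hyperbolic_def by blast
    then have "k\<^sup>2 * (?b x x * ?b y y) \<le> k\<^sup>2 * (?b x y)\<^sup>2" by (intro mult_left_mono) auto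
    then show "k * ?b x x * (k * ?b y y) \<le> (k * ?b x y)\<^sup>2"
      by (simp add: power_mult_distrib power2_eq_square algebra_simps)
  qed
qed

lemma hyperbolic_Plus_right:
  assumes fin: "finite A" "finite B" and H: "hyperbolic B H" and k: "k \<ge> 0"
    and Q: "\<And>b b'. Q (Inr b) (Inr b') = k * H b b'" "\<And>a x. Q (Inl a) x = 0" "\<And>x a. Q x (Inl a) = 0"
  shows "hyperbolic (A <+> B) Q"
proof -
  have eq: "bil (A <+> B) Q x y = k * bil B H (\<lambda>b. x (Inr b)) (\<lambda>b. y (Inr b))" for x y
    unfolding bil_def using fin Q by (simp add: sum_Plus sum_distrib_left algebra_simps)
  show ?thesis unfolding hyperbolic_def eq
  proof (intro allI impI)
    fix x y :: "'a + 'b \<Rightarrow> real"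
    let ?b = "\<lambda>x y. bil B H (\<lambda>b. x (Inr b)) (\<lambda>b. y (Inr b))"
    assume "k * ?b y y > 0"
    then have "?b y y > 0" using k by (simp add: zero_less_mult_iff)
    then have "?b x x * ?b y y \<le> (?b x y)\<^sup>2" using H unfolding hyperbolic_def by blast
    then have "k\<^sup>2 * (?b x x * ?b y y) \<le> k\<^sup>2 * (?b x y)\<^sup>2" by (intro mult_left_mono) auto
    then show "k * ?b x x * (k * ?b y y) \<le> (k * ?b x y)\<^sup>2"
      by (simp add: power_mult_distrib power2_eq_square algebra_simps)
  qed
qed

text \<open>The form is a symmetrized product of two linear forms \<open>F\<close> and
  \<open>G\<close>; the gap in the inequality is the square of
  \<open>F x * G y - G x * F y\<close>.\<close>

lemma hyperbolic_Plus_cross: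
  assumes fin: "finite A" "finite B"
    and Q: "\<And>a b. Q (Inl a) (Inr b) = f a * g b" "\<And>a b. Q (Inr b) (Inl a) = f a * g b"
      "\<And>a a'. Q (Inl a) (Inl a') = 0" "\<And>b b'. Q (Inr b) (Inr b') = 0"
  shows "hyperbolic (A <+> B) Q"
proof -
  define F where "F = (\<lambda>x :: 'a + 'b \<Rightarrow> real. \<Sum>a\<in>A. f a * x (Inl a))"
  define G where "G = (\<lambda>x :: 'a + 'b \<Rightarrow> real. \<Sum>b\<in>B. g b * x (Inr b))"
  have eq: "bil (A <+> B) Q x y = F x * G y + G x * F y" for x y
    unfolding bil_def F_def G_def sum_product using fin Q by (simp add: sum_Plus algebra_simps)
  have "(F x * G x + G x * F x) * (F y * G y + G y * F y) \<le> (F x * G y + G x * F y)\<^sup>2" for x y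
    using zero_le_power2[of "F x * G y - G x * F y"] by (simp add: power2_eq_square algebra_simps)
  then show ?thesis unfolding hyperbolic_def eq by blast
qed

text \<open>A quadratic derivative of the product is a multiple of a quadratic derivative of one
  factor, a product of linear derivatives of both factors, or zero. Connecting variables can always
  be taken among the two copies of \<open>None\<close>.\<close>

lemma lorentzian_pair_coef:
  assumes fin: "finite E" and q: "0 < q" "q < 1"
    and u1: "parallel_weight E q u1" and u2: "parallel_weight E q u2"
  shows "lorentzian_coeffs (pair_vars E) (2 * card E) (pair_coef (card E) u1 u2)
    (\<lambda>m. supp (card E) (lft m) \<and> supp (card E) (rgt m))"
proof
  let ?n = "card E"
  have p1: "u1 S > 0" and p2: "u2 S > 0" for S
    using u1 u2 by (simp_all add: parallel_weight_def)
  show "finite (pair_vars E)" using fin by simp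
  show "0 \<le> pair_coef ?n u1 u2 m" for m
    unfolding pair_coef_def by (intro mult_nonneg_nonneg coef_nonneg p1 p2)
  show "0 < pair_coef ?n u1 u2 m"
    if "size m = 2 * ?n" and s: "supp ?n (lft m) \<and> supp ?n (rgt m)" for m
  proof -
    have "size (lft m) = ?n" "size (rgt m) = ?n" using size_lft_rgt[of m] that by (auto simp: supp_def)
    then show ?thesis unfolding pair_coef_def using s p1 p2 by (intro mult_pos_pos coef_pos) auto
  qed
  show "pair_coef ?n u1 u2 m = 0" if "\<not> (supp ?n (lft m) \<and> supp ?n (rgt m))" for m
    using that by (auto simp: pair_coef_def coef_zero)
  show "supp ?n (lft m) \<and> supp ?n (rgt m)"
    if "supp ?n (lft (add_mset a m)) \<and> supp ?n (rgt (add_mset a m))" for a m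
    using that by (cases a) (auto dest: supp_mono)
  show "\<exists>a\<in>pair_vars E. supp ?n (lft (add_mset a m)) \<and> supp ?n (rgt (add_mset a m))"
    if s: "supp ?n (lft m) \<and> supp ?n (rgt m)" and "size m < 2 * ?n" for m
  proof (cases "size (lft m) < ?n")
    case True
    then show ?thesis using s by (intro bexI[of _ "Inl None"]) (auto simp: supp_add_None)
  next
    case False
    then have "size (rgt m) < ?n" using size_lft_rgt[of m] that by simp
    then show ?thesis using s by (intro bexI[of _ "Inr None"]) (auto simp: supp_add_None)
  qed
  let ?P = "\<lambda>m. supp ?n (lft m) \<and> supp ?n (rgt m)"
  show "?P (add_mset i (add_mset j m)) \<or>
      (\<exists>k\<in>pair_vars E. ?P (add_mset i (add_mset k m)) \<and> ?P (add_mset k (add_mset j m)))"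
    if sz: "size m + 3 \<le> 2 * ?n" and i: "?P (add_mset i m)" and j: "?P (add_mset j m)" for m i j
  proof (cases i; cases j)
    fix a b assume "i = Inl a" "j = Inr b"
    then show ?thesis using i j by simp
  next
    fix a b assume "i = Inr b" "j = Inl a"
    then show ?thesis using i j by simp
  next
    fix a b assume ab: "i = Inl a" "j = Inl b"
    show ?thesis
    proof (cases "size (lft m) + 2 \<le> ?n")
      case True
      then have "?P (add_mset i (add_mset (Inl None) m)) \<and> ?P (add_mset (Inl None) (add_mset j m))"
        using ab i j supp_add_None[of ?n "add_mset a (lft m)"] supp_add_None[of ?n "add_mset b (lft m)"]
        by (simp add: add_mset_commute)
      then show ?thesis by blast
    next
      case False
      \<comment> \<open>The first factor has degree only for one more variable; since three degrees
        are left in total, the second factor has room for its \<open>None\<close>.\<close>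
      then have "size (rgt m) < ?n" using sz size_lft_rgt[of m] i ab by (simp add: supp_def)
      then have "?P (add_mset i (add_mset (Inr None) m)) \<and> ?P (add_mset (Inr None) (add_mset j m))"
        using ab i j supp_add_None[of ?n "rgt m"] by simp
      then show ?thesis by blast
    qed
  next
    fix a b assume ab: "i = Inr a" "j = Inr b"
    show ?thesis
    proof (cases "size (rgt m) + 2 \<le> ?n")
      case True
      then have "?P (add_mset i (add_mset (Inr None) m)) \<and> ?P (add_mset (Inr None) (add_mset j m))"
        using ab i j supp_add_None[of ?n "add_mset a (rgt m)"] supp_add_None[of ?n "add_mset b (rgt m)"]
        by (simp add: add_mset_commute)
      then show ?thesis by blast
    next
      case False
      then have "size (lft m) < ?n" using sz size_lft_rgt[of m] i ab by (simp add: supp_def)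
      then have "?P (add_mset i (add_mset (Inl None) m)) \<and> ?P (add_mset (Inl None) (add_mset j m))"
        using ab i j supp_add_None[of ?n "lft m"] by simp
      then show ?thesis by blast
    qed
  qed
  show "hyperbolic (pair_vars E) (\<lambda>i j. pair_coef ?n u1 u2 (add_mset i (add_mset j m)))"
    (is "hyperbolic _ ?Q")
    if sz: "size m + 2 = 2 * ?n" and m: "set_mset m \<subseteq> pair_vars E" for m
  proof -
    have fv: "finite (vars E)" using fin by simp
    have ml: "set_mset (lft m) \<subseteq> vars E"
    proof
      fix a assume "a \<in># lft m"
      then have "Inl a \<in># m" by (metis count_greater_zero_iff count_lft)
      then show "a \<in> vars E" using m by blast
    qed
    have mr: "set_mset (rgt m) \<subseteq> vars E"
    proof
      fix a assume "a \<in># rgt m"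
      then have "Inr a \<in># m" by (metis count_greater_zero_iff count_rgt)
      then show "a \<in> vars E" using m by blast
    qed
    consider "size (lft m) + 2 = ?n" "size (rgt m) = ?n" | "size (lft m) + 1 = ?n" "size (rgt m) + 1 = ?n"
      | "size (lft m) = ?n" "size (rgt m) + 2 = ?n"
      | "size (lft m) > ?n \<or> size (rgt m) > ?n"
      using sz size_lft_rgt[of m] by linarith
    then show ?thesis
    proof cases
      case 1
      show ?thesis
      proof (rule hyperbolic_Plus_left[OF fv fv hyperbolic_coef[OF fin u1 q 1(1) ml] coef_nonneg[of u2 ?n "rgt m"]])
        show "?Q (Inl a) (Inl a') = coef ?n u2 (rgt m) * coef ?n u1 (add_mset a (add_mset a' (lft m)))" for a a'
          by (simp add: pair_coef_def)
        have "size (rgt (add_mset (Inr b) (add_mset x m))) \<noteq> ?n" for b x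
          using 1 by (cases x) auto
        then show "?Q (Inr b) x = 0" for b x by (simp add: pair_coef_def coef_zero del: lft_rgt_simps)
        then show "?Q x (Inr b) = 0" for b x by (simp add: add_mset_commute[of x])
      qed (rule p2)
    next
      case 2
      show ?thesis
      proof (rule hyperbolic_Plus_cross[OF fv fv])
        show "?Q (Inl a) (Inr b) = coef ?n u1 (add_mset a (lft m)) * coef ?n u2 (add_mset b (rgt m))" for a b
          by (simp add: pair_coef_def)
        show "?Q (Inr b) (Inl a) = coef ?n u1 (add_mset a (lft m)) * coef ?n u2 (add_mset b (rgt m))" for a b
          by (simp add: pair_coef_def)
        show "?Q (Inl a) (Inl a') = 0" for a a'
          using 2 by (simp add: pair_coef_def coef_zero)
        show "?Q (Inr a) (Inr a') = 0" for a a'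
          using 2 by (simp add: pair_coef_def coef_zero)
      qed
    next
      case 3
      show ?thesis
      proof (rule hyperbolic_Plus_right[OF fv fv hyperbolic_coef[OF fin u2 q 3(2) mr] coef_nonneg[of u1 ?n "lft m"]])
        show "?Q (Inr a) (Inr a') = coef ?n u1 (lft m) * coef ?n u2 (add_mset a (add_mset a' (rgt m)))" for a a'
          by (simp add: pair_coef_def)
        have "size (lft (add_mset (Inl b) (add_mset x m))) \<noteq> ?n" for b x
          using 3 by (cases x) auto
        then show "?Q (Inl b) x = 0" for b x by (simp add: pair_coef_def coef_zero del: lft_rgt_simps)
        then show "?Q x (Inl b) = 0" for b x by (simp add: add_mset_commute[of x])
      qed (rule p1)
    next
      case 4
      have "size (lft (add_mset i (add_mset j m))) \<noteq> ?n \<or> size (rgt (add_mset i (add_mset j m))) \<noteq> ?n" for i j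
        using 4 by (cases i; cases j) auto
      then have "?Q i j = 0" for i j
        unfolding pair_coef_def by (metis coef_zero mult_zero_left mult_zero_right)
      then show ?thesis by (simp add: hyperbolic_def bil_def)
    qed
  qed
qed

section \<open>Evaluation of the mixed derivatives\<close>

text \<open>
  \<open>m\<close> is the product of the first-copy variables in \<open>A\<close>, the second-copy variables in \<open>B\<close>, and the powers
  \<open>i\<close> and \<open>j\<close> of the two homogenizing variables.
\<close>
definition monomial :: "('a option + 'a option) multiset \<Rightarrow> 'a set \<Rightarrow> 'a set \<Rightarrow> nat \<Rightarrow> nat \<Rightarrow> bool" where
  "monomial m A B i j \<longleftrightarrow>
     (\<forall>e. count m (Inl (Some e)) = of_bool (e \<in> A)) \<and> (\<forall>e. count m (Inr (Some e)) = of_bool (e \<in> B)) \<and>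
     count m (Inl None) = i \<and> count m (Inr None) = j"

lemma monomial_empty: "monomial {#} {} {} 0 0"
  by (simp add: monomial_def)

lemma monomial_add:
  assumes "monomial m A B i j"
  shows "monomial (add_mset (Inl None) m) A B (Suc i) j"
    and "monomial (add_mset (Inr None) m) A B i (Suc j)"
    and "e \<notin> A \<Longrightarrow> monomial (add_mset (Inl (Some e)) m) (insert e A) B i j"
    and "e \<notin> B \<Longrightarrow> monomial (add_mset (Inr (Some e)) m) A (insert e B) i j"
  using assms by (auto simp: monomial_def)

lemma monomial_factors:
  assumes "monomial m A B i j"
  shows "{e. Some e \<in># lft m} = A" "{e. Some e \<in># rgt m} = B"
    "size (lft m) = i + card A" "size (rgt m) = j + card B"
    "\<forall>e. count (lft m) (Some e) \<le> 1" "\<forall>e. count (rgt m) (Some e) \<le> 1"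
proof -
  show A: "{e. Some e \<in># lft m} = A" and B: "{e. Some e \<in># rgt m} = B"
    using assms by (auto simp: monomial_def simp flip: count_greater_zero_iff)
  show l: "\<forall>e. count (lft m) (Some e) \<le> 1" and r: "\<forall>e. count (rgt m) (Some e) \<le> 1"
    using assms by (auto simp: monomial_def)
  show "size (lft m) = i + card A" "size (rgt m) = j + card B"
    using size_eq_count_None_plus[OF l] size_eq_count_None_plus[OF r] assms A B
    by (simp_all add: monomial_def)
qed

lemma pair_coef_monomial:
  assumes "monomial m A B i j" "i + card A = n" "j + card B = n"
  shows "pair_coef n u1 u2 m = fact i * u1 A * (fact j * u2 B)"
  using assms monomial_factors[OF assms(1)] by (simp add: pair_coef_def coef_def monomial_def)

lemma mixed_pair_coef_zero:
  assumes "\<not> (supp n (lft m) \<and> supp n (rgt m))" "size m + length vs = 2 * n"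
  shows "mixed V (pair_coef n u1 u2) vs m = 0"
proof (rule mixed_zero_outside_support[where P = "\<lambda>m. supp n (lft m) \<and> supp n (rgt m)", OF _ _ assms])
  show "pair_coef n u1 u2 m = 0" if "\<not> (supp n (lft m) \<and> supp n (rgt m))" for m
    using that by (auto simp: pair_coef_def coef_zero)
  show "supp n (lft m) \<and> supp n (rgt m)"
    if "supp n (lft (add_mset a m)) \<and> supp n (rgt (add_mset a m))" for a m
    using that by (cases a) (auto dest: supp_mono)
qed

definition dir_z :: "'a option + 'a option \<Rightarrow> real" where
  "dir_z a = of_bool (a = Inl None \<or> a = Inr None)"

definition dir_w :: "'a option + 'a option \<Rightarrow> real" where
  "dir_w a = of_bool (\<exists>e. a = Inl (Some e))"

definition dir_pair :: "'a \<Rightarrow> 'a option + 'a option \<Rightarrow> real" where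
  "dir_pair e a = of_bool (a = Inl (Some e) \<or> a = Inr (Some e))"

lemma sum_pair_vars:
  fixes f :: "'a option + 'a option \<Rightarrow> real"
  assumes "finite E"
  shows "(\<Sum>a\<in>pair_vars E. f a) = f (Inl None) + (\<Sum>e\<in>E. f (Inl (Some e))) +
     (f (Inr None) + (\<Sum>e\<in>E. f (Inr (Some e))))"
proof -
  have "(\<Sum>a\<in>vars E. g a) = g None + (\<Sum>e\<in>E. g (Some e))" for g :: "'a option \<Rightarrow> real"
    using assms by (subst sum.insert) (auto simp: sum.reindex)
  then show ?thesis using assms by (simp add: sum_Plus)
qed

lemma mixed_dir_z:
  assumes fin: "finite E"
  shows "mixed (pair_vars E) c (dir_z # vs) m =
    mixed (pair_vars E) c vs (add_mset (Inl None) m) + mixed (pair_vars E) c vs (add_mset (Inr None) m)"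
  using fin by (simp add: sum_pair_vars dir_z_def)

lemma mixed_dir_w:
  assumes fin: "finite E"
  shows "mixed (pair_vars E) c (dir_w # vs) m =
    (\<Sum>e\<in>E. mixed (pair_vars E) c vs (add_mset (Inl (Some e)) m))"
  unfolding mixed.simps sum_pair_vars[OF fin] by (simp add: dir_w_def)

lemma mixed_dir_pair:
  assumes fin: "finite E" and e: "e \<in> E"
  shows "mixed (pair_vars E) c (dir_pair e # vs) m =
    mixed (pair_vars E) c vs (add_mset (Inl (Some e)) m) + mixed (pair_vars E) c vs (add_mset (Inr (Some e)) m)"
  using fin e by (simp add: sum_pair_vars dir_pair_def of_bool_def if_distrib[of "\<lambda>x. x * _"] cong: if_cong)

text \<open>Degrees force exactly \<open>a\<close> of the derivatives onto the first factor and
  \<open>b\<close> onto the second, which leaves \<open>a + b\<close> choose \<open>a\<close>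
  orders. The factor \<open>fact a * fact b\<close> clears the denominator of this binomial.\<close>

lemma mixed_replicate_dir_z:
  assumes fin: "finite E"
    and "monomial m A B i j" "i + a + card A = n" "j + b + card B = n"
  shows "mixed (pair_vars E) (pair_coef n u1 u2) (replicate (a + b) dir_z) m * (fact a * fact b) =
    fact (a + b) * (fact (i + a) * u1 A * (fact (j + b) * u2 B))"
  using assms(2-)
proof (induction "a + b" arbitrary: m a b i j)
  case 0
  then show ?case by (simp add: pair_coef_monomial)
next
  case (Suc r)
  let ?M = "\<lambda>r m. mixed (pair_vars E) (pair_coef n u1 u2) (replicate r dir_z) m"
  let ?K = "fact (i + a) * u1 A * (fact (j + b) * u2 B)"
  note fac = monomial_factors[OF Suc.prems(1)]
  have sz: "size m + Suc r = 2 * n" using Suc fac size_lft_rgt[of m] by simp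
  have l: "?M r (add_mset (Inl None) m) * (fact a * fact b) = a * (fact r * ?K)"
  proof (cases a)
    case 0
    \<comment> \<open>With \<open>a = 0\<close> the first factor is already exhausted, so a further
      derivative kills it.\<close>
    then have "\<not> supp n (lft (add_mset (Inl None) m))" using Suc.prems fac by (simp add: supp_def)
    then have "?M r (add_mset (Inl None) m) = 0"
      using sz by (intro mixed_pair_coef_zero) auto
    then show ?thesis using 0 by simp
  next
    case (Suc a')
    have "?M (a' + b) (add_mset (Inl None) m) * (fact a' * fact b) =
      fact (a' + b) * (fact (Suc i + a') * u1 A * (fact (j + b) * u2 B))"
      using Suc.hyps(2) Suc.prems \<open>a = Suc a'\<close>
      by (intro Suc.hyps(1) monomial_add(1)) auto
    moreover have "a' + b = r" using Suc.hyps(2) \<open>a = Suc a'\<close> by simp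
    moreover have "Suc i + a' = i + a" using \<open>a = Suc a'\<close> by simp
    moreover have "?M r (add_mset (Inl None) m) * (fact a * fact b) =
      a * (?M r (add_mset (Inl None) m) * (fact a' * fact b))"
      unfolding \<open>a = Suc a'\<close> fact_Suc by (simp only: mult_ac)
    ultimately show ?thesis by (simp only:)
  qed
  have r: "?M r (add_mset (Inr None) m) * (fact a * fact b) = b * (fact r * ?K)"
  proof (cases b)
    case 0
    then have "\<not> supp n (rgt (add_mset (Inr None) m))" using Suc.prems fac by (simp add: supp_def)
    then have "?M r (add_mset (Inr None) m) = 0"
      using sz by (intro mixed_pair_coef_zero) auto
    then show ?thesis using 0 by simp
  next
    case (Suc b')
    have "?M (a + b') (add_mset (Inr None) m) * (fact a * fact b') =
      fact (a + b') * (fact (i + a) * u1 A * (fact (Suc j + b') * u2 B))"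
      using Suc.hyps(2) Suc.prems \<open>b = Suc b'\<close>
      by (intro Suc.hyps(1) monomial_add(2)) auto
    moreover have "a + b' = r" using Suc.hyps(2) \<open>b = Suc b'\<close> by simp
    moreover have "Suc j + b' = j + b" using \<open>b = Suc b'\<close> by simp
    moreover have "?M r (add_mset (Inr None) m) * (fact a * fact b) =
      b * (?M r (add_mset (Inr None) m) * (fact a * fact b'))"
      unfolding \<open>b = Suc b'\<close> fact_Suc by (simp only: mult_ac)
    ultimately show ?thesis by (simp only:)
  qed
  have "?M (a + b) m = ?M r (add_mset (Inl None) m) + ?M r (add_mset (Inr None) m)"
    unfolding Suc.hyps(2)[symmetric] replicate_Suc by (rule mixed_dir_z[OF fin])
  then have "?M (a + b) m * (fact a * fact b) = (a + b) * (fact r * ?K)"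
    using l r by (simp add: algebra_simps)
  also have "\<dots> = fact (a + b) * ?K" unfolding Suc.hyps(2)[symmetric] by simp
  finally show ?case .
qed

text \<open>Double counting: a set \<open>D\<close> arises once for each of its \<open>Suc k\<close>
  elements in the role of \<open>e\<close>.\<close>

lemma sum_insert_subsets:
  fixes g :: "'a set \<Rightarrow> real"
  assumes fin: "finite X"
  shows "(\<Sum>e\<in>X. \<Sum>C | C \<subseteq> X - {e} \<and> card C = k. g (insert e C)) =
    (Suc k) * (\<Sum>D | D \<subseteq> X \<and> card D = Suc k. g D)"
proof -
  have "(\<Sum>e\<in>X. \<Sum>C | C \<subseteq> X - {e} \<and> card C = k. g (insert e C)) =
     (\<Sum>(e, C)\<in>(SIGMA e:X. {C. C \<subseteq> X - {e} \<and> card C = k}). g (insert e C))"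
    using fin by (intro sum.Sigma) auto
  also have "\<dots> = (\<Sum>(D, e)\<in>(SIGMA D:{D. D \<subseteq> X \<and> card D = Suc k}. D). g D)"
  proof (rule sum.reindex_bij_witness[where i = "\<lambda>(D, e). (e, D - {e})" and j = "\<lambda>(e, C). (insert e C, e)"],
      goal_cases)
    case (1 p)
    then show ?case by (cases p) (auto dest: subsetD)
  next
    case (2 p)
    then obtain e C where p: "p = (e, C)" "e \<in> X" "C \<subseteq> X - {e}" "card C = k" by auto
    then have "card (insert e C) = Suc k" using fin finite_subset[of C X] by (subst card_insert_disjoint) auto
    then show ?case using p by auto
  next
    case (3 p)
    then show ?case by (cases p) auto
  next
    case (4 p)
    then show ?case by (cases p) auto
  qed auto
  also have "\<dots> = (\<Sum>D | D \<subseteq> X \<and> card D = Suc k. \<Sum>e\<in>D. g D)"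
    using fin finite_subset by (intro sum.Sigma[symmetric]) auto
  also have "\<dots> = (Suc k) * (\<Sum>D | D \<subseteq> X \<and> card D = Suc k. g D)"
    by (simp add: sum_distrib_left)
  finally show ?thesis .
qed

text \<open>The directions \<open>dir_w\<close> add the elements of a \<open>k\<close>-set
  \<open>C\<close> to \<open>A\<close> in any of \<open>fact k\<close> orders. The directions
  \<open>dir_z\<close> then contribute \<open>fact r\<close>, the other factorials of
  \<open>mixed_replicate_dir_z\<close> cancelling.\<close>

lemma mixed_replicate_dir_w:
  assumes fin: "finite E"
    and "monomial m A B 0 0" "A \<subseteq> E" "B \<subseteq> E" "card A + k + card B + r = 2 * card E"
  shows "mixed (pair_vars E) (pair_coef (card E) u1 u2) (replicate k dir_w @ replicate r dir_z) m =
    fact k * fact r * (\<Sum>C | C \<subseteq> E - A \<and> card C = k. u1 (A \<union> C)) * u2 B"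
  using assms(2-)
proof (induction k arbitrary: m A)
  case 0
  have "card A \<le> card E" "card B \<le> card E" using 0 fin by (auto intro: card_mono)
  then obtain a b where a: "a + card A = card E" and b: "b + card B = card E"
    by (metis le_add_diff_inverse2)
  then have "r = a + b" using 0 by simp
  have "{C. C \<subseteq> E - A \<and> card C = 0} = {{}}"
    using fin by (auto simp: finite_subset[OF _ finite_Diff])
  moreover have "mixed (pair_vars E) (pair_coef (card E) u1 u2) (replicate (a + b) dir_z) m * (fact a * fact b) =
    fact (a + b) * (fact (0 + a) * u1 A * (fact (0 + b) * u2 B))"
    using a b by (intro mixed_replicate_dir_z[OF fin 0(1)]) auto
  ultimately show ?case using \<open>r = a + b\<close> by simp
next
  case (Suc k)
  let ?M = "\<lambda>k m. mixed (pair_vars E) (pair_coef (card E) u1 u2) (replicate k dir_w @ replicate r dir_z) m"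
  note fac = monomial_factors[OF Suc.prems(1)]
  have finA: "finite A" using Suc.prems fin finite_subset by blast
  have "?M (Suc k) m = (\<Sum>e\<in>E. ?M k (add_mset (Inl (Some e)) m))"
    unfolding replicate_Suc append_Cons by (rule mixed_dir_w[OF fin])
  also have "\<dots> = (\<Sum>e\<in>E - A. ?M k (add_mset (Inl (Some e)) m))"
  proof (rule sum.mono_neutral_right)
    show "\<forall>e\<in>E - (E - A). ?M k (add_mset (Inl (Some e)) m) = 0"
    proof
      fix e assume "e \<in> E - (E - A)"
      then have "count (lft (add_mset (Inl (Some e)) m)) (Some e) > 1"
        using Suc.prems(1) by (simp add: monomial_def)
      then have "\<not> supp (card E) (lft (add_mset (Inl (Some e)) m))" unfolding supp_def by (metis not_le)
      then show "?M k (add_mset (Inl (Some e)) m) = 0"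
        using Suc.prems fac size_lft_rgt[of m] by (intro mixed_pair_coef_zero) auto
    qed
  qed (use fin in auto)
  also have "\<dots> = (\<Sum>e\<in>E - A. fact k * fact r * (\<Sum>C | C \<subseteq> (E - A) - {e} \<and> card C = k. u1 (A \<union> insert e C)) * u2 B)"
  proof (intro sum.cong refl)
    fix e assume e: "e \<in> E - A"
    have "?M k (add_mset (Inl (Some e)) m) =
      fact k * fact r * (\<Sum>C | C \<subseteq> E - insert e A \<and> card C = k. u1 (insert e A \<union> C)) * u2 B"
      using e Suc.prems finA by (intro Suc.IH monomial_add(3)) auto
    moreover have "E - insert e A = E - A - {e}" by auto
    ultimately show "?M k (add_mset (Inl (Some e)) m) =
      fact k * fact r * (\<Sum>C | C \<subseteq> (E - A) - {e} \<and> card C = k. u1 (A \<union> insert e C)) * u2 B" by simp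
  qed
  also have "\<dots> = fact k * fact r * (\<Sum>e\<in>E - A. \<Sum>C | C \<subseteq> (E - A) - {e} \<and> card C = k. u1 (A \<union> insert e C)) * u2 B"
    by (simp only: sum_distrib_left sum_distrib_right)
  also have "\<dots> = fact (Suc k) * fact r * (\<Sum>C | C \<subseteq> E - A \<and> card C = Suc k. u1 (A \<union> C)) * u2 B"
    using sum_insert_subsets[of "E - A" "\<lambda>C. u1 (A \<union> C)" k] fin by (simp add: algebra_simps)
  finally show ?case .
qed

lemma sum_Pow_insert:
  assumes "finite X" "e \<notin> X"
  shows "(\<Sum>S\<in>Pow (insert e X). f S) = (\<Sum>S\<in>Pow X. f S) + (\<Sum>S\<in>Pow X. f (insert e S))"
proof -
  have "inj_on (insert e) (Pow X)" using assms by (auto simp: inj_on_def)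
  moreover have "Pow X \<inter> insert e ` Pow X = {}" using assms by auto
  ultimately show ?thesis using assms
    by (simp add: Pow_insert sum.union_disjoint sum.reindex)
qed

text \<open>Each pair direction sends its element to the first or to the second copy;
  \<open>S\<close> collects those sent to the second. \<open>G\<close> evaluates what remains once
  \<open>A\<close> and \<open>B\<close> partition \<open>E\<close>.\<close>

lemma mixed_dir_pairs:
  assumes fin: "finite E"
    and G: "\<And>m A B. monomial m A B 0 0 \<Longrightarrow> A \<union> B = E \<Longrightarrow> A \<inter> B = {} \<Longrightarrow>
      mixed (pair_vars E) c vs m = G A B"
    and "monomial m A B 0 0" "A \<union> B \<union> set es = E" "A \<inter> B = {}" "(A \<union> B) \<inter> set es = {}" "distinct es"
  shows "mixed (pair_vars E) c (map dir_pair es @ vs) m = (\<Sum>S\<in>Pow (set es). G (A \<union> (set es - S)) (B \<union> S))"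
  using assms(3-)
proof (induction es arbitrary: m A B)
  case Nil
  then show ?case using G[of m A B] by simp
next
  case (Cons e es)
  let ?X = "set es"
  have e: "e \<notin> ?X" "e \<notin> A" "e \<notin> B" "e \<in> E" using Cons.prems by auto
  have "mixed (pair_vars E) c (map dir_pair (e # es) @ vs) m =
    mixed (pair_vars E) c (map dir_pair es @ vs) (add_mset (Inl (Some e)) m) +
    mixed (pair_vars E) c (map dir_pair es @ vs) (add_mset (Inr (Some e)) m)"
    using mixed_dir_pair[OF fin e(4)] by simp
  also have "mixed (pair_vars E) c (map dir_pair es @ vs) (add_mset (Inl (Some e)) m) =
     (\<Sum>S\<in>Pow ?X. G (insert e A \<union> (?X - S)) (B \<union> S))"
    using Cons.prems e by (intro Cons.IH monomial_add(3)) auto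
  also have "\<dots> = (\<Sum>S\<in>Pow ?X. G (A \<union> (insert e ?X - S)) (B \<union> S))"
    using e by (intro sum.cong refl arg_cong2[of _ _ _ _ G]) auto
  also have "mixed (pair_vars E) c (map dir_pair es @ vs) (add_mset (Inr (Some e)) m) =
     (\<Sum>S\<in>Pow ?X. G (A \<union> (?X - S)) (insert e B \<union> S))"
    using Cons.prems e by (intro Cons.IH monomial_add(4)) auto
  also have "\<dots> = (\<Sum>S\<in>Pow ?X. G (A \<union> (insert e ?X - insert e S)) (B \<union> insert e S))"
    using e by (intro sum.cong refl arg_cong2[of _ _ _ _ G]) auto
  finally show ?case
    using sum_Pow_insert[OF finite_set e(1), of "\<lambda>S. G (A \<union> (insert e ?X - S)) (B \<union> S)"] by simp
qed

lemma mixed_pair_coef_eval: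
  assumes fin: "finite E" and es: "set es = E" "distinct es" and k: "k + r = card E"
  shows "mixed (pair_vars E) (pair_coef (card E) u1 u2) (map dir_pair es @ replicate k dir_w @ replicate r dir_z) {#} =
    fact k * fact r * (\<Sum>S\<in>Pow E. \<Sum>C | C \<subseteq> S \<and> card C = k. u1 ((E - S) \<union> C) * u2 S)"
proof -
  have "mixed (pair_vars E) (pair_coef (card E) u1 u2) (map dir_pair es @ replicate k dir_w @ replicate r dir_z) {#} =
    (\<Sum>S\<in>Pow (set es). fact k * fact r *
      (\<Sum>C | C \<subseteq> E - ({} \<union> (set es - S)) \<and> card C = k. u1 (({} \<union> (set es - S)) \<union> C)) * u2 ({} \<union> S))"
  proof (rule mixed_dir_pairs[OF fin _ monomial_empty])
    fix m A B assume m: "monomial m A B 0 0" and AB: "A \<union> B = E" "A \<inter> B = {}"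
    have "card A + card B = card E" using AB fin by (metis card_Un_disjoint finite_Un)
    then show "mixed (pair_vars E) (pair_coef (card E) u1 u2) (replicate k dir_w @ replicate r dir_z) m =
      fact k * fact r * (\<Sum>C | C \<subseteq> E - A \<and> card C = k. u1 (A \<union> C)) * u2 B"
      using m AB k by (intro mixed_replicate_dir_w[OF fin]) auto
  qed (use es in auto)
  also have "\<dots> = (\<Sum>S\<in>Pow E. fact k * fact r * (\<Sum>C | C \<subseteq> S \<and> card C = k. u1 ((E - S) \<union> C) * u2 S))"
  proof (intro sum.cong)
    fix S assume "S \<in> Pow E"
    then have "E - (E - S) = S" by auto
    then show "fact k * fact r *
      (\<Sum>C | C \<subseteq> E - ({} \<union> (set es - S)) \<and> card C = k. u1 (({} \<union> (set es - S)) \<union> C)) * u2 ({} \<union> S) =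
      fact k * fact r * (\<Sum>C | C \<subseteq> S \<and> card C = k. u1 ((E - S) \<union> C) * u2 S)"
      by (simp add: es(1) sum_distrib_right)
  qed (simp add: es)
  finally show ?thesis by (simp only: sum_distrib_left)
qed

text \<open>
  Here \<open>0 ^ 0 = 1\<close> turns the weights into indicators of independence. In a term of the sum, \<open>S\<close> is the
  larger independent set and \<open>C\<close> the difference of the two sets.
\<close>
lemma J_eq_sum:
  assumes M1: "matroid E indep1" and M2: "matroid E indep2"
  defines "u1 \<equiv> \<lambda>S. (0::real) ^ (card (E - S) - rank_of indep1 (E - S))"
    and "u2 \<equiv> \<lambda>S. (0::real) ^ (card S - rank_of indep2 S)"
  shows "(\<Sum>S\<in>Pow E. \<Sum>C | C \<subseteq> S \<and> card C = k. u1 ((E - S) \<union> C) * u2 S) = real (J indep1 indep2 k)"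
proof -
  interpret m1: matroid E indep1 by (rule M1)
  interpret m2: matroid E indep2 by (rule M2)
  note fin = m1.finite_carrier
  have zero_power: "(0::real) ^ (card A - rank_of ind A) = of_bool (ind A)" if "matroid E ind" "A \<subseteq> E" for ind A
  proof -
    interpret matroid E ind by (rule that(1))
    have "finite A" using that fin finite_subset by blast
    then show ?thesis using rank_of_le_card[of A] rank_of_eq_card_iff[of A] by (auto simp: power_0_left)
  qed
  let ?P = "SIGMA S:Pow E. {C. C \<subseteq> S \<and> card C = k}"
  have "(\<Sum>S\<in>Pow E. \<Sum>C | C \<subseteq> S \<and> card C = k. u1 ((E - S) \<union> C) * u2 S) =
    (\<Sum>S\<in>Pow E. \<Sum>C | C \<subseteq> S \<and> card C = k. of_bool (indep1 (S - C) \<and> indep2 S))"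
  proof (intro sum.cong refl)
    fix S C assume S: "S \<in> Pow E" and C: "C \<in> {C. C \<subseteq> S \<and> card C = k}"
    then have "E - ((E - S) \<union> C) = S - C" by auto
    moreover have "S - C \<subseteq> E" using S by auto
    ultimately show "u1 ((E - S) \<union> C) * u2 S = of_bool (indep1 (S - C) \<and> indep2 S)"
      unfolding u1_def u2_def using S zero_power[OF M1, of "S - C"] zero_power[OF M2, of S] by simp
  qed
  also have "\<dots> = (\<Sum>(S, C)\<in>?P. of_bool (indep1 (S - C) \<and> indep2 S))"
    using fin finite_subset by (intro sum.Sigma) (auto intro: finite_subset[OF _ finite_Pow_iff[THEN iffD2]])
  also have "\<dots> = real (card {(S, C) \<in> ?P. indep1 (S - C) \<and> indep2 S})"
  proof -
    have "finite ?P" using fin by (intro finite_SigmaI) (auto intro: finite_subset[of _ "Pow E"])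
    have "(\<Sum>(S, C)\<in>?P. of_bool (indep1 (S - C) \<and> indep2 S) :: real) =
        (\<Sum>p\<in>?P. of_bool (case p of (S, C) \<Rightarrow> indep1 (S - C) \<and> indep2 S))"
      by (intro sum.cong) auto
    also have "\<dots> = real (card (?P \<inter> {p. case p of (S, C) \<Rightarrow> indep1 (S - C) \<and> indep2 S}))"
      using \<open>finite ?P\<close> by (simp only: of_bool_def sum.If_cases) simp
    also have "?P \<inter> {p. case p of (S, C) \<Rightarrow> indep1 (S - C) \<and> indep2 S} =
        {(S, C) \<in> ?P. indep1 (S - C) \<and> indep2 S}" by auto
    finally show ?thesis .
  qed
  also have "card {(S, C) \<in> ?P. indep1 (S - C) \<and> indep2 S} = J indep1 indep2 k"
    unfolding J_def indep_pairs_def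
  proof (rule bij_betw_same_card[of "\<lambda>(S, C). (S - C, S)"], rule bij_betw_byWitness[where f' = "\<lambda>(I1, I2). (I2, I2 - I1)"])
    show "(\<lambda>(S, C). (S - C, S)) ` {(S, C) \<in> ?P. indep1 (S - C) \<and> indep2 S} \<subseteq>
      {(I1, I2). indep1 I1 \<and> indep2 I2 \<and> I1 \<subseteq> I2 \<and> card (I2 - I1) = k}"
      by (auto simp: double_diff)
    show "(\<lambda>(I1, I2). (I2, I2 - I1)) ` {(I1, I2). indep1 I1 \<and> indep2 I2 \<and> I1 \<subseteq> I2 \<and> card (I2 - I1) = k} \<subseteq>
      {(S, C) \<in> ?P. indep1 (S - C) \<and> indep2 S}"
      using m2.indep_subset_carrier by (auto simp: double_diff)
  qed (auto simp: double_diff)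
  finally show ?thesis .
qed

section \<open>The inequality for the numbers \<open>J\<close>\<close>

theorem J_fact_log_concave:
  assumes M1: "matroid E indep1" and M2: "matroid E indep2" and k: "k + 2 + r = card E"
  shows "(fact k * fact (r + 2) * real (J indep1 indep2 k)) * (fact (k + 2) * fact r * real (J indep1 indep2 (k + 2)))
    \<le> (fact (k + 1) * fact (r + 1) * real (J indep1 indep2 (k + 1)))\<^sup>2"
proof -
  interpret m1: matroid E indep1 by (rule M1)
  interpret m2: matroid E indep2 by (rule M2)
  note fin = m1.finite_carrier
  obtain es where es: "set es = E" "distinct es" using finite_distinct_list[OF fin] by blast
  define u1 where "u1 = (\<lambda>(q::real) S. q ^ (card (E - S) - rank_of indep1 (E - S)))"
  define u2 where "u2 = (\<lambda>(q::real) S. q ^ (card S - rank_of indep2 S))"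
  define C where "C = (\<lambda>q. pair_coef (card E) (u1 q) (u2 q))"
  define vs where "vs = map dir_pair es @ replicate k dir_w @ replicate r (dir_z :: 'a option + 'a option \<Rightarrow> real)"
  let ?M = "\<lambda>vs. mixed (pair_vars E) (C 0) vs {#}"
  have len: "length vs + 2 = 2 * card E"
    using k es distinct_card[OF es(2)] by (simp add: vs_def)
  \<comment> \<open>\<open>vs\<close> holds the \<open>2 * card E - 2\<close> common directions.
    Completing it by two copies of \<open>dir_z\<close>, one of each, or two copies of
    \<open>dir_w\<close> yields the indices \<open>k\<close>, \<open>k + 1\<close> and
    \<open>k + 2\<close>.\<close>
  have "?M (dir_z # dir_z # vs) * ?M (dir_w # dir_w # vs) \<le> (?M (dir_z # dir_w # vs))\<^sup>2"
  proof (rule alexandrov_fenchel_limit[OF _ _ len])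
    show "lorentzian_coeffs (pair_vars E) (2 * card E) (C q) (\<lambda>m. supp (card E) (lft m) \<and> supp (card E) (rgt m))"
      if "0 < q" "q < 1" for q
      unfolding C_def u1_def u2_def
      by (rule lorentzian_pair_coef[OF fin that m1.parallel_weight_conullity[OF that(1)]
            m2.parallel_weight_nullity[OF that(1)]])
    show "((\<lambda>q. C q m) \<longlongrightarrow> C 0 m) (at_right 0)" for m
    proof -
      have "((\<lambda>q. coef (card E) (u q) M) \<longlongrightarrow> coef (card E) (u 0) M) (at_right 0)"
        if "\<And>S. ((\<lambda>q. u q S) \<longlongrightarrow> u 0 S) (at_right (0::real))" for u :: "real \<Rightarrow> 'a set \<Rightarrow> real" and M
      proof (cases "size M = card E \<and> (\<forall>e. count M (Some e) \<le> 1)")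
        case True
        show ?thesis unfolding coef_def if_P[OF True] by (intro tendsto_mult_left that)
      next
        case False
        show ?thesis unfolding coef_def if_not_P[OF False] by (rule tendsto_const)
      qed
      moreover have "((\<lambda>q. u1 q S) \<longlongrightarrow> u1 0 S) (at_right 0)" "((\<lambda>q. u2 q S) \<longlongrightarrow> u2 0 S) (at_right 0)" for S
        unfolding u1_def u2_def by (intro tendsto_intros)+
      ultimately show ?thesis unfolding C_def pair_coef_def by (intro tendsto_mult) auto
    qed
    show "v a \<ge> 0" if "v \<in> set vs" for v a
      using that by (auto simp: vs_def dir_pair_def dir_w_def dir_z_def)
  qed (auto simp: dir_w_def dir_z_def)
  \<comment> \<open>Mixed derivatives are symmetric, so only the multiplicities of the directions
    matter.\<close>
  moreover have eval: "?M ws = fact i * fact j * real (J indep1 indep2 i)"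
    if "mset ws = mset (map dir_pair es @ replicate i dir_w @ replicate j dir_z)" "i + j = card E" for ws i j
    unfolding mixed_mset[OF that(1)] C_def mixed_pair_coef_eval[OF fin es that(2)]
    using J_eq_sum[OF M1 M2, of i] by (simp add: u1_def u2_def)
  have "?M (dir_z # dir_z # vs) = fact k * fact (r + 2) * real (J indep1 indep2 k)"
    using k by (intro eval) (auto simp: vs_def)
  moreover have "?M (dir_w # dir_w # vs) = fact (k + 2) * fact r * real (J indep1 indep2 (k + 2))"
    using k by (intro eval) (auto simp: vs_def)
  moreover have "?M (dir_z # dir_w # vs) = fact (k + 1) * fact (r + 1) * real (J indep1 indep2 (k + 1))"
    using k by (intro eval) (auto simp: vs_def)
  ultimately show ?thesis by simp
qed

theorem corollary2:
  fixes E :: "'a set" and indep\<^sub>1 indep\<^sub>2 :: "'a set \<Rightarrow> bool" and n k :: nat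
  assumes "matroid E indep\<^sub>1"
    and "matroid E indep\<^sub>2"
    and "card E = n"
    and "k + 2 \<le> n"
  shows "(real (J indep\<^sub>1 indep\<^sub>2 k) / real (n choose k)) *
         (real (J indep\<^sub>1 indep\<^sub>2 (k + 2)) / real (n choose (k + 2)))
         \<le> (real (J indep\<^sub>1 indep\<^sub>2 (k + 1)) / real (n choose (k + 1)))\<^sup>2"
proof -
  obtain r where r: "k + 2 + r = n" using assms(4) le_Suc_ex by blast
  \<comment> \<open>All three quotients acquire the denominator \<open>fact n\<close>, and the
    numerators are the quantities of \<open>J_fact_log_concave\<close>.\<close>
  have quot: "x / real (n choose i) = fact i * fact j * x / fact n" if "i + j = n" for i j and x :: real
  proof -
    have "n - i = j" "i \<le> n" using that by auto
    then show ?thesis by (simp add: binomial_fact)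
  qed
  have "(fact k * fact (r + 2) * real (J indep\<^sub>1 indep\<^sub>2 k)) * (fact (k + 2) * fact r * real (J indep\<^sub>1 indep\<^sub>2 (k + 2)))
    \<le> (fact (k + 1) * fact (r + 1) * real (J indep\<^sub>1 indep\<^sub>2 (k + 1)))\<^sup>2"
    using assms r by (intro J_fact_log_concave) auto
  then have "(fact k * fact (r + 2) * real (J indep\<^sub>1 indep\<^sub>2 k)) * (fact (k + 2) * fact r * real (J indep\<^sub>1 indep\<^sub>2 (k + 2))) / (fact n)\<^sup>2
    \<le> (fact (k + 1) * fact (r + 1) * real (J indep\<^sub>1 indep\<^sub>2 (k + 1)))\<^sup>2 / (fact n)\<^sup>2"
    by (intro divide_right_mono) auto
  moreover have "k + (r + 2) = n" "k + 2 + r = n" "k + 1 + (r + 1) = n" using r by auto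
  note quot[OF this(1)] quot[OF this(2)] quot[OF this(3)]
  ultimately show ?thesis by (simp only: times_divide_times_eq power_divide power2_eq_square[of "fact n"])
qed

end
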